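(* Let $k_1<\dots<k_I$ be integers in $\mathbb N$. Let $s\le k_1$ be such that either $s=0$ or $s-1$ is a double knot of $p_0$. Let $s'\ge k_I$ be such that either $s'$ is a double knot of $p_0$ or $s'\ge S+1$. Let $z\le s$ and $z'\ge s'$ be arbitrary integers with $z\ge0$. Then, with probability one, there exists $n_0$ such that for all $n\ge n_0$, $(\hat p_n(k_1),\dots,\hat p_n(k_I))$ is the restriction to $\{k_1,\dots,k_I\}$ of the minimizer of $\frac12\sum_{k=z}^{z'}(p_n(k)-p(k))^2$ over the set of convex vectors $(p(z),p(z+1),\dots,p(z'))$ (i.e. $p(k+1)-2p(k)+p(k-1)\ge0$ for $z<k<z'$). Moreover, $\sqrt n\big(\hat p_n(k_1)-p_0(k_1),\dots,\hat p_n(k_I)-p_0(k_I)\big)$ converges in distribution to the restriction to $\{k_1,\dots,k_I\}$ of the minimizer of $\frac12\sum_{k=z}^{z'}(g(k)-\mathbb W(k))^2$ over the set of vectors $g=(g(z),\dots,g(z'))$ that are convex on $\{s_j,\dots,s_{j+1}\}$ for all $j=0,\dots,m$ with $s_j\ge z$ and $s_{j+1}\le z'$.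
   Context: Let $\mathbb N=\{0,1,\dots\}$. For a real sequence $p$ and $k\ge1$ let $\Delta p(k)=p(k+1)-2p(k)+p(k-1)$; $p$ is convex if $\Delta p(k)\ge0$ for all $k\ge1$; $\mathcal C$ is the set of convex sequences with $\sum_kp(k)^2<\infty$. A knot of $p$ is an integer $k\ge1$ with $\Delta p(k)>0$; a point $t$ is a double knot of $p$ if both $t$ and $t+1$ are knots of $p$. Let $p_0$ be a convex probability mass function on $\mathbb N$ with support $\{0,\dots,S\}$, $S\ge1$. Let $X_1,X_2,\dots$ be i.i.d. with pmf $p_0$, $p_n(j)=\frac1n\sum_{i\le n}\mathbb 1\{X_i=j\}$, and let $\hat p_n$ be the unique minimizer over $\mathcal C$ of $\frac12\sum_j(p_n(j)-p(j))^2$. Let $F_{p_0}(k)=\sum_{j=0}^kp_0(j)$, $F_{p_0}(-1)=0$, let $\mathbb U$ be a standard Brownian bridge on $[0,1]$ and $\mathbb W(k)=\mathbb U(F_{p_0}(k))-\mathbb U(F_{p_0}(k-1))$ for $k\in\mathbb N$ (so $\mathbb W(k)=0$ for $k\ge S+1$). Let $s_1<\dots<s_m$ be the knots of $p_0$ in $\{1,\dots,S\}$ (possibly $m=0$), $s_0=0$, $s_{m+1}=S+1$. A vector $g$ is convex on $\{a,\dots,b\}$ if $g(k+1)-2g(k)+g(k-1)\ge0$ for all $a<k<b$. *)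

theory Defs
  imports "HOL-Probability.Probability"
begin

text \<open>Second difference of a sequence at k (used for k \<ge> 1).\<close>
definition sdiff :: "(nat \<Rightarrow> real) \<Rightarrow> nat \<Rightarrow> real" where
  "sdiff p k = p (k + 1) - 2 * p k + p (k - 1)"

definition convex_seq :: "(nat \<Rightarrow> real) \<Rightarrow> bool" where
  "convex_seq p \<longleftrightarrow> (\<forall>k\<ge>1. sdiff p k \<ge> 0)"

definition convex_L2 :: "(nat \<Rightarrow> real) set" where
  "convex_L2 = {p. convex_seq p \<and> summable (\<lambda>k. (p k)\<^sup>2)}"

definition knot :: "(nat \<Rightarrow> real) \<Rightarrow> nat \<Rightarrow> bool" where
  "knot p k \<longleftrightarrow> k \<ge> 1 \<and> sdiff p k > 0"

definition double_knot :: "(nat \<Rightarrow> real) \<Rightarrow> nat \<Rightarrow> bool" where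
  "double_knot p t \<longleftrightarrow> knot p t \<and> knot p (t + 1)"

definition convex_on_range :: "(nat \<Rightarrow> real) \<Rightarrow> nat \<Rightarrow> nat \<Rightarrow> bool" where
  "convex_on_range g a b \<longleftrightarrow> (\<forall>k. a < k \<and> k < b \<longrightarrow> sdiff g k \<ge> 0)"

text \<open>Empirical pmf of X_0,...,X_{n-1} (the paper's X_1,...,X_n).\<close>
definition emp_pmf :: "(nat \<Rightarrow> 'a \<Rightarrow> nat) \<Rightarrow> nat \<Rightarrow> 'a \<Rightarrow> nat \<Rightarrow> real" where
  "emp_pmf X n \<omega> j = real (card {i \<in> {..<n}. X i \<omega> = j}) / real n"

definition ls_obj :: "(nat \<Rightarrow> real) \<Rightarrow> (nat \<Rightarrow> real) \<Rightarrow> real" where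
  "ls_obj y p = 1/2 * (\<Sum>j. (y j - p j)\<^sup>2)"

definition convex_lse :: "(nat \<Rightarrow> real) \<Rightarrow> (nat \<Rightarrow> real)" where
  "convex_lse y = (THE p. p \<in> convex_L2 \<and> (\<forall>q \<in> convex_L2. ls_obj y p \<le> ls_obj y q))"

text \<open>Minimiser of 1/2 sum_{k=z}^{z'} (y k - g k)^2 over vectors (g z, ..., g z')
  satisfying constraint P; vectors are represented as sequences vanishing outside {z..z'}.\<close>
definition sq_argmin :: "((nat \<Rightarrow> real) \<Rightarrow> bool) \<Rightarrow> nat \<Rightarrow> nat \<Rightarrow> (nat \<Rightarrow> real) \<Rightarrow> (nat \<Rightarrow> real)" where
  "sq_argmin P z z' y = (THE g. (\<forall>k. k \<notin> {z..z'} \<longrightarrow> g k = 0) \<and> P g \<and>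
     (\<forall>h. (\<forall>k. k \<notin> {z..z'} \<longrightarrow> h k = 0) \<and> P h \<longrightarrow>
        1/2 * (\<Sum>k=z..z'. (y k - g k)\<^sup>2) \<le> 1/2 * (\<Sum>k=z..z'. (y k - h k)\<^sup>2)))"

text \<open>Extended knot set {s_0, s_1, ..., s_m, s_{m+1}} = {0, S+1} \<union> knots of p in {1..S}.\<close>
definition ext_knots :: "(nat \<Rightarrow> real) \<Rightarrow> nat \<Rightarrow> nat set" where
  "ext_knots p S = {0, S + 1} \<union> {k \<in> {1..S}. knot p k}"

definition piecewise_convex :: "(nat \<Rightarrow> real) \<Rightarrow> nat \<Rightarrow> nat \<Rightarrow> nat \<Rightarrow> (nat \<Rightarrow> real) \<Rightarrow> bool" where
  "piecewise_convex p S z z' g \<longleftrightarrow>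
     (\<forall>a \<in> ext_knots p S. \<forall>b \<in> ext_knots p S.
        a < b \<and> (\<forall>c \<in> ext_knots p S. \<not> (a < c \<and> c < b)) \<and> z \<le> a \<and> b \<le> z'
        \<longrightarrow> convex_on_range g a b)"

definition centered_normal :: "'b measure \<Rightarrow> ('b \<Rightarrow> real) \<Rightarrow> real \<Rightarrow> bool" where
  "centered_normal N Z v \<longleftrightarrow>
     (v = 0 \<and> Z \<in> borel_measurable N \<and> (AE \<omega> in N. Z \<omega> = 0)) \<or>
     (v > 0 \<and> distributed N lborel Z (\<lambda>x. ennreal (normal_density 0 (sqrt v) x)))"

text \<open>Standard Brownian bridge on [0,1]: centered Gaussian process with covariance
  min s t - s t (every finite linear combination is centered normal with the right
  variance), with almost surely continuous paths.\<close>
definition brownian_bridge :: "'b measure \<Rightarrow> (real \<Rightarrow> 'b \<Rightarrow> real) \<Rightarrow> bool" where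
  "brownian_bridge N U \<longleftrightarrow> prob_space N \<and>
     (\<forall>t \<in> {0..1}. U t \<in> borel_measurable N) \<and>
     (\<forall>T a. finite T \<and> T \<subseteq> {0..1} \<longrightarrow>
        centered_normal N (\<lambda>\<omega>. \<Sum>t\<in>T. a t * U t \<omega>)
          (\<Sum>s\<in>T. \<Sum>t\<in>T. a s * a t * (min s t - s * t))) \<and>
     (AE \<omega> in N. continuous_on {0..1} (\<lambda>t. U t \<omega>))"

text \<open>Convergence in distribution of random vectors (finitely many nonzero coordinates
  here) with values in nat \<Rightarrow> real (product topology): bounded continuous test functions.\<close>
definition conv_in_distr ::
  "'a measure \<Rightarrow> (nat \<Rightarrow> 'a \<Rightarrow> (nat \<Rightarrow> real)) \<Rightarrow> 'b measure \<Rightarrow> ('b \<Rightarrow> (nat \<Rightarrow> real)) \<Rightarrow> bool" where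
  "conv_in_distr M Y N Z \<longleftrightarrow>
     (\<forall>n. Y n \<in> borel_measurable M) \<and> Z \<in> borel_measurable N \<and>
     (\<forall>f :: (nat \<Rightarrow> real) \<Rightarrow> real. continuous_on UNIV f \<and> bounded (range f) \<longrightarrow>
        (\<lambda>n. integral\<^sup>L M (\<lambda>\<omega>. f (Y n \<omega>))) \<longlonglongrightarrow> integral\<^sup>L N (\<lambda>\<omega>. f (Z \<omega>)))"

end

theory Submission
  imports Defs
begin

text \<open>
  All the minimisers are projections onto cones \<open>sdiff g k \<ge> 0\<close> (\<open>k \<in> C\<close>), characterised by the
  variational inequality. When the empirical pmf is close to \<open>p0\<close>, the convexity constraints at the
  knots of \<open>p0\<close> are slack, so the estimator minus \<open>p0\<close> is exactly the projection of the empirical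
  pmf minus \<open>p0\<close> onto the cone whose constraints sit at the non-knots. A double knot separates the
  constraints on its two sides, so this projection can be computed on \<open>{z..z'}\<close>. The closeness holds
  eventually almost surely by Hoeffding and Borel-Cantelli. As the projection is positively
  homogeneous and continuous, the limit law follows by continuous mapping from the multivariate
  central limit theorem for the empirical pmf, which is reduced to the one-dimensional one by the
  Cramer-Wold device.
\<close>

section \<open>Projections onto cones of second differences\<close>

text \<open>The estimator is a \<open>THE\<close> over square-summable sequences, so it becomes
  accessible only once a minimiser is exhibited and checked against all convex competitors. For that
  reason the competitors in \<open>is_proj\<close> range over all sequences: a convex sequence minus
  \<open>p0\<close> can be tested directly. The candidate correction lives on
  \<open>{0..S+1}\<close>, one point beyond the support, because \<open>S + 1\<close> is the last
  coordinate that a constraint at a non-knot can read; convexity further right reduces to a sign at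
  \<open>S + 1\<close>. Two adjacent knots are what separates, since a second difference reads three
  points: around a single knot \<open>t\<close> the constraints centred at \<open>t - 1\<close> and
  \<open>t + 1\<close> still share the coordinate \<open>t\<close>. The global, windowed and
  limiting problems have different index sets and constraints. On the block between \<open>s\<close>
  and \<open>s'\<close> the same constraints remain, since the pieces cut by the window, which the
  limiting problem drops, lie outside that block. How close the empirical pmf must be depends on
  \<open>p0\<close> alone, so the comparison is deterministic and randomness enters only through the
  data.\<close>

definition is_proj :: "nat set \<Rightarrow> nat \<Rightarrow> nat \<Rightarrow> (nat \<Rightarrow> real) \<Rightarrow> (nat \<Rightarrow> real) \<Rightarrow> bool" where
  "is_proj C a b w g \<longleftrightarrow> (\<forall>k. k \<notin> {a..b} \<longrightarrow> g k = 0) \<and> (\<forall>k\<in>C. 0 \<le> sdiff g k) \<and>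
     (\<forall>h. (\<forall>k\<in>C. 0 \<le> sdiff h k) \<longrightarrow> (\<Sum>k=a..b. (w k - g k) * (h k - g k)) \<le> 0)"

lemma is_projD:
  assumes "is_proj C a b w g"
  shows "k \<notin> {a..b} \<Longrightarrow> g k = 0" "k \<in> C \<Longrightarrow> 0 \<le> sdiff g k"
    "(\<And>k. k \<in> C \<Longrightarrow> 0 \<le> sdiff h k) \<Longrightarrow> (\<Sum>k=a..b. (w k - g k) * (h k - g k)) \<le> 0"
  using assms unfolding is_proj_def by auto

lemma sdiff_scaleR: "sdiff (\<lambda>k. c * g k) k = c * sdiff g k"
  by (simp add: sdiff_def algebra_simps)

lemma sdiff_add: "sdiff (\<lambda>k. g k + h k) k = sdiff g k + sdiff h k"
  by (simp add: sdiff_def algebra_simps)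

lemma sdiff_diff: "sdiff (\<lambda>k. g k - h k) k = sdiff g k - sdiff h k"
  by (simp add: sdiff_def algebra_simps)

lemma is_proj_scale:
  assumes "is_proj C a b w g" "c > 0"
  shows "is_proj C a b (\<lambda>k. c * w k) (\<lambda>k. c * g k)"
  unfolding is_proj_def
proof (intro conjI allI impI ballI)
  fix k assume "k \<notin> {a..b}" then show "c * g k = 0" using is_projD(1)[OF assms(1)] by simp
next
  fix k assume "k \<in> C" then show "0 \<le> sdiff (\<lambda>k. c * g k) k"
    using is_projD(2)[OF assms(1)] assms(2) by (simp add: sdiff_scaleR)
next
  fix h assume h: "\<forall>k\<in>C. 0 \<le> sdiff h k"
  have "(\<Sum>k=a..b. (w k - g k) * (h k / c - g k)) \<le> 0"
  proof (rule is_projD(3)[OF assms(1)])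
    fix k assume "k \<in> C" then show "0 \<le> sdiff (\<lambda>k. h k / c) k"
      using h assms(2) sdiff_scaleR[of "1/c" h k] by simp
  qed
  then have "c^2 * (\<Sum>k=a..b. (w k - g k) * (h k / c - g k)) \<le> 0"
    using assms(2) by (simp add: mult_le_0_iff)
  also have "c^2 * (\<Sum>k=a..b. (w k - g k) * (h k / c - g k)) = (\<Sum>k=a..b. (c * w k - c * g k) * (h k - c * g k))"
    unfolding sum_distrib_left using assms(2)
    by (intro sum.cong refl) (simp add: field_simps power2_eq_square)
  finally show "(\<Sum>k=a..b. (c * w k - c * g k) * (h k - c * g k)) \<le> 0" .
qed

lemma sum_sq_expand:
  fixes w g h :: "nat \<Rightarrow> real"
  shows "(\<Sum>k\<in>A. (w k - h k)\<^sup>2) =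
    (\<Sum>k\<in>A. (w k - g k)\<^sup>2) - 2 * (\<Sum>k\<in>A. (w k - g k) * (h k - g k)) + (\<Sum>k\<in>A. (h k - g k)\<^sup>2)"
  by (simp add: sum_distrib_left sum.distrib[symmetric] sum_subtractf[symmetric] power2_eq_square algebra_simps)

text \<open>Expanding the square around \<open>g\<close>, the variational inequality shows that any
  competitor costs at least the squared distance to \<open>g\<close> more. This yields minimality
  and uniqueness at once, as the definite description requires.\<close>

lemma sq_argmin_eq:
  assumes "\<And>g. P g \<longleftrightarrow> (\<forall>k\<in>C. 0 \<le> sdiff g k)" "is_proj C a b w g"
  shows "sq_argmin P a b w = g"
  unfolding sq_argmin_def
proof (rule the_equality)
  have min: "(\<Sum>k=a..b. (w k - g k)\<^sup>2) + (\<Sum>k=a..b. (h k - g k)\<^sup>2) \<le> (\<Sum>k=a..b. (w k - h k)\<^sup>2)"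
    if "P h" for h
  proof -
    have "(\<Sum>k=a..b. (w k - g k) * (h k - g k)) \<le> 0"
      using is_projD(3)[OF assms(2)] that assms(1) by blast
    then show ?thesis using sum_sq_expand[of w h "{a..b}" g] by simp
  qed
  show "(\<forall>k. k \<notin> {a..b} \<longrightarrow> g k = 0) \<and> P g \<and>
    (\<forall>h. (\<forall>k. k \<notin> {a..b} \<longrightarrow> h k = 0) \<and> P h \<longrightarrow>
      1/2 * (\<Sum>k=a..b. (w k - g k)\<^sup>2) \<le> 1/2 * (\<Sum>k=a..b. (w k - h k)\<^sup>2))"
  proof (intro conjI allI impI)
    fix h assume "(\<forall>k. k \<notin> {a..b} \<longrightarrow> h k = 0) \<and> P h"
    then have "(\<Sum>k=a..b. (w k - g k)\<^sup>2) + (\<Sum>k=a..b. (h k - g k)\<^sup>2) \<le> (\<Sum>k=a..b. (w k - h k)\<^sup>2)"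
      using min by blast
    moreover have "0 \<le> (\<Sum>k=a..b. (h k - g k)\<^sup>2)" by (simp add: sum_nonneg)
    ultimately show "1/2 * (\<Sum>k=a..b. (w k - g k)\<^sup>2) \<le> 1/2 * (\<Sum>k=a..b. (w k - h k)\<^sup>2)" by linarith
  qed (use is_projD(1,2)[OF assms(2)] assms(1) in blast)+
  fix h assume h: "(\<forall>k. k \<notin> {a..b} \<longrightarrow> h k = 0) \<and> P h \<and>
    (\<forall>f. (\<forall>k. k \<notin> {a..b} \<longrightarrow> f k = 0) \<and> P f \<longrightarrow>
      1/2 * (\<Sum>k=a..b. (w k - h k)\<^sup>2) \<le> 1/2 * (\<Sum>k=a..b. (w k - f k)\<^sup>2))"
  have "P g" using is_projD(2)[OF assms(2)] assms(1) by blast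
  with h is_projD(1)[OF assms(2)]
  have "1/2 * (\<Sum>k=a..b. (w k - h k)\<^sup>2) \<le> 1/2 * (\<Sum>k=a..b. (w k - g k)\<^sup>2)" by blast
  with min[of h] h have "(\<Sum>k=a..b. (h k - g k)\<^sup>2) \<le> 0" by auto
  then have "(\<Sum>k=a..b. (h k - g k)\<^sup>2) = 0" by (simp add: order_antisym sum_nonneg)
  then have "\<forall>k\<in>{a..b}. (h k - g k)\<^sup>2 = 0" by (subst (asm) sum_nonneg_eq_0_iff) auto
  then show "h = g" using h is_projD(1)[OF assms(2)] by (auto simp: fun_eq_iff)
qed

lemma is_proj_unique:
  assumes "is_proj C a b w g" "is_proj C a b w h"
  shows "g = h"
  using sq_argmin_eq[of "\<lambda>g. \<forall>k\<in>C. 0 \<le> sdiff g k", OF _ assms(1)]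
    sq_argmin_eq[of "\<lambda>g. \<forall>k\<in>C. 0 \<le> sdiff g k", OF _ assms(2)] by simp

section \<open>Existence and Lipschitz continuity of the projection\<close>

lemma abs_le_L2_set: "finite A \<Longrightarrow> k \<in> A \<Longrightarrow> \<bar>f k\<bar> \<le> L2_set f A"
  using member_le_L2_set[of A k "\<lambda>k. \<bar>f k\<bar>"] by (simp add: L2_set_def)

text \<open>Vectors are encoded as sequences, so compactness is Tychonoff's theorem in the product
  topology.\<close>

lemma compact_box:
  fixes B :: "'i \<Rightarrow> real set"
  assumes "\<And>k. compact (B k)"
  shows "compact {g. \<forall>k. g k \<in> B k}"
proof -
  have "compactin (product_topology (\<lambda>i::'i. euclidean) UNIV) (PiE UNIV B)"
    unfolding compactin_PiE using assms by simp
  moreover have "PiE UNIV B = {g. \<forall>k. g k \<in> B k}" by auto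
  ultimately show ?thesis by (simp add: euclidean_product_topology)
qed

lemma continuous_on_sdiff: "continuous_on A (\<lambda>g. sdiff g k)"
  unfolding sdiff_def
  by (intro continuous_intros continuous_on_subset[OF continuous_on_product_coordinates]) auto

lemma is_proj_exists:
  assumes C: "C \<subseteq> {a<..<b}"
  shows "\<exists>g. is_proj C a b w g"
proof -
  \<comment> \<open>A vector with a coordinate beyond twice the norm of the data costs at least as
    much as the zero vector, so the search can be confined to this box.\<close>
  define R where "R = 2 * L2_set w {a..b}"
  define B where "B k = (if k \<in> {a..b} then {-R..R} else {0})" for k
  define T where "T = {g. \<forall>k. g k \<in> B k} \<inter> {g. \<forall>k\<in>C. 0 \<le> sdiff g k}"
  define J where "J g = (\<Sum>k=a..b. (w k - g k)\<^sup>2)" for g :: "nat \<Rightarrow> real"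
  have R0: "0 \<le> R" by (simp add: R_def L2_set_nonneg)
  have "closed (\<Inter>k\<in>C. {g. 0 \<le> sdiff g k})"
    by (intro closed_INT ballI closed_Collect_le continuous_on_const continuous_on_sdiff)
  also have "(\<Inter>k\<in>C. {g. 0 \<le> sdiff g k}) = {g. \<forall>k\<in>C. 0 \<le> sdiff g k}" by auto
  finally have "compact T"
    unfolding T_def by (intro compact_Int_closed compact_box) (auto simp: B_def)
  moreover have zT: "(\<lambda>_. 0) \<in> T" by (auto simp: T_def B_def R0 sdiff_def)
  moreover have "continuous_on T J" unfolding J_def
    by (intro continuous_intros continuous_on_subset[OF continuous_on_product_coordinates]) auto
  ultimately obtain g where g: "g \<in> T" "\<And>h. h \<in> T \<Longrightarrow> J g \<le> J h"
    using continuous_attains_inf[of T J] by blast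
  have gmin: "J g \<le> J h" if h: "\<And>k. k \<notin> {a..b} \<Longrightarrow> h k = 0" "\<And>k. k \<in> C \<Longrightarrow> 0 \<le> sdiff h k" for h
  proof (cases "h \<in> T")
    case True then show ?thesis using g by blast
  next
    case False
    then obtain k where "h k \<notin> B k" using h(2) by (auto simp: T_def)
    then have k: "k \<in> {a..b}" "\<bar>h k\<bar> > R"
      using h(1)[of k] by (auto simp: B_def split: if_splits)
    have wk: "\<bar>w k\<bar> \<le> L2_set w {a..b}"
      using k(1) by (intro abs_le_L2_set) auto
    then have "L2_set w {a..b} \<le> \<bar>w k - h k\<bar>" using k(2) unfolding R_def by linarith
    then have "(L2_set w {a..b})\<^sup>2 \<le> (w k - h k)\<^sup>2"
      using power_mono[OF _ L2_set_nonneg, of _ _ _ 2] by force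
    also have "\<dots> \<le> J h" unfolding J_def using k(1) by (intro member_le_sum) auto
    also have "(L2_set w {a..b})\<^sup>2 = J (\<lambda>_. 0)"
      unfolding L2_set_def J_def by (simp add: sum_nonneg)
    finally show ?thesis using g(2)[OF zT] by linarith
  qed
  have gC: "0 \<le> sdiff g k" if "k \<in> C" for k using g that by (auto simp: T_def)
  have g0: "g k = 0" if "k \<notin> {a..b}" for k
    using g that by (auto simp: T_def B_def split: if_splits)
  have "(\<Sum>k=a..b. (w k - g k) * (h k - g k)) \<le> 0" if h: "\<forall>k\<in>C. 0 \<le> sdiff h k" for h
  proof -
    \<comment> \<open>First-order condition: moving from \<open>g\<close> a fraction
      \<open>t\<close> of the way to \<open>h\<close> cannot lower the cost, which reads
      \<open>2 * A \<le> t * D\<close>; small \<open>t\<close> then excludes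
      \<open>A > 0\<close>.\<close>
    define A where "A = (\<Sum>k=a..b. (w k - g k) * (h k - g k))"
    define D where "D = (\<Sum>k=a..b. (h k - g k)\<^sup>2)"
    have D0: "0 \<le> D" by (simp add: D_def sum_nonneg)
    have key: "2 * A \<le> t * D" if t: "0 < t" "t \<le> 1" for t
    proof -
      \<comment> \<open>Cutting off outside the window is harmless: a constraint centred in
        \<open>{a<..<b}\<close> reads indices of \<open>{a..b}\<close> only.\<close>
      define f where "f k = (if k \<in> {a..b} then g k + t * (h k - g k) else 0)" for k
      have "J g \<le> J f"
      proof (rule gmin)
        fix k assume k: "k \<in> C"
        then have "a < k" "k < b" using C by auto
        then have "k - 1 \<in> {a..b}" "k \<in> {a..b}" "k + 1 \<in> {a..b}" by auto
        then have "sdiff f k = (1 - t) * sdiff g k + t * sdiff h k"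
          by (simp add: sdiff_def f_def algebra_simps)
        also have "\<dots> \<ge> 0" using gC[OF k] h k t by simp
        finally show "0 \<le> sdiff f k" .
      qed (auto simp: f_def)
      also have "J f = J g - 2 * (\<Sum>k=a..b. (w k - g k) * (f k - g k)) + (\<Sum>k=a..b. (f k - g k)\<^sup>2)"
        unfolding J_def by (rule sum_sq_expand)
      also have "(\<Sum>k=a..b. (w k - g k) * (f k - g k)) = t * A"
        unfolding A_def sum_distrib_left by (intro sum.cong) (auto simp: f_def)
      also have "(\<Sum>k=a..b. (f k - g k)\<^sup>2) = t^2 * D"
        unfolding D_def sum_distrib_left by (intro sum.cong) (auto simp: f_def power_mult_distrib)
      finally have "t * (2 * A) \<le> t * (t * D)" by (simp add: power2_eq_square)
      then show ?thesis using t by (simp add: mult_le_cancel_left)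
    qed
    show ?thesis
    proof (rule ccontr)
      assume "\<not> ?thesis"
      then have A: "0 < A" by (simp add: A_def)
      \<comment> \<open>Chosen so that \<open>t * D \<le> A\<close>; the summand 1 covers the case
        \<open>D = 0\<close>.\<close>
      define t where "t = min 1 (A / (D + 1))"
      have "0 < t" "t \<le> 1" using A D0 by (auto simp: t_def)
      have "t * D \<le> A / (D + 1) * D" using D0 by (intro mult_right_mono) (auto simp: t_def)
      also have "\<dots> \<le> A" using A D0 by (simp add: field_simps)
      finally show False using key[OF \<open>0 < t\<close> \<open>t \<le> 1\<close>] A by linarith
    qed
  qed
  then have "is_proj C a b w g" using gC g0 by (auto simp: is_proj_def)
  then show ?thesis by blast
qed

text \<open>Each variational inequality is tested at the other projection. Their sum bounds the
  squared distance of the projections by the inner product with the difference of the data, and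
  Cauchy-Schwarz makes the projection nonexpansive.\<close>

lemma is_proj_lipschitz:
  assumes "is_proj C a b v g" "is_proj C a b w h"
  shows "\<bar>g k - h k\<bar> \<le> L2_set (\<lambda>k. v k - w k) {a..b}"
proof (cases "k \<in> {a..b}")
  case False
  then show ?thesis using is_projD(1)[OF assms(1)] is_projD(1)[OF assms(2)] by (simp add: L2_set_nonneg)
next
  case True
  let ?L = "\<lambda>f. L2_set f {a..b}"
  let ?d = "\<lambda>k. g k - h k" and ?e = "\<lambda>k. v k - w k"
  have "(\<Sum>k=a..b. (v k - g k) * (h k - g k)) \<le> 0" "(\<Sum>k=a..b. (w k - h k) * (g k - h k)) \<le> 0"
    using is_projD(3)[OF assms(1)] is_projD(3)[OF assms(2)] is_projD(2)[OF assms(1)] is_projD(2)[OF assms(2)]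
    by blast+
  then have "(\<Sum>k=a..b. (v k - g k) * (h k - g k)) + (\<Sum>k=a..b. (w k - h k) * (g k - h k)) \<le> 0" by simp
  also have "(\<Sum>k=a..b. (v k - g k) * (h k - g k)) + (\<Sum>k=a..b. (w k - h k) * (g k - h k))
      = (\<Sum>k=a..b. (?d k)\<^sup>2) - (\<Sum>k=a..b. ?e k * ?d k)"
    by (simp add: sum.distrib[symmetric] sum_subtractf[symmetric] power2_eq_square algebra_simps)
  finally have "(\<Sum>k=a..b. (?d k)\<^sup>2) \<le> (\<Sum>k=a..b. ?e k * ?d k)" by simp
  also have "\<dots> \<le> (\<Sum>k=a..b. \<bar>?e k\<bar> * \<bar>?d k\<bar>)"
    by (intro sum_mono) (metis abs_mult abs_ge_self)
  also have "\<dots> \<le> ?L ?e * ?L ?d" by (rule L2_set_mult_ineq)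
  also have "(\<Sum>k=a..b. (?d k)\<^sup>2) = ?L ?d * ?L ?d"
    unfolding L2_set_def by (simp add: sum_nonneg)
  finally have le: "?L ?d * ?L ?d \<le> ?L ?e * ?L ?d" .
  have "?L ?d \<le> ?L ?e"
  proof (cases "?L ?d = 0")
    case True then show ?thesis by simp
  next
    case False
    then have "0 < ?L ?d" using L2_set_nonneg[of ?d "{a..b}"] by linarith
    with le show ?thesis by (rule mult_right_le_imp_le)
  qed
  moreover have "\<bar>?d k\<bar> \<le> ?L ?d"
    using True by (intro abs_le_L2_set) auto
  ultimately show ?thesis by linarith
qed

lemma is_proj_zero: "is_proj C a b (\<lambda>_. 0) (\<lambda>_. 0)"
  by (simp add: is_proj_def sdiff_def)

text \<open>If no constraint is centred at one of \<open>s - 1, s, t, t + 1\<close>, the coordinates in \<open>{s..t}\<close> share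
  no constraint with the others.\<close>
lemma is_proj_restrict:
  assumes g: "is_proj C a b w g" and st: "a \<le> s" "t \<le> b"
    and C: "s \<ge> 1 \<Longrightarrow> s - 1 \<notin> C" "s \<notin> C" "t \<notin> C" "t + 1 \<notin> C" "0 \<notin> C"
  shows "is_proj (C \<inter> {s<..<t}) s t w (\<lambda>k. if k \<in> {s..t} then g k else 0)"
    (is "is_proj _ s t w ?g")
  unfolding is_proj_def
proof (intro conjI allI impI ballI)
  fix k assume "k \<in> C \<inter> {s<..<t}"
  then have "sdiff ?g k = sdiff g k" "k \<in> C" by (auto simp: sdiff_def)
  then show "0 \<le> sdiff ?g k" using is_projD(2)[OF g] by simp
next
  fix h assume h: "\<forall>k\<in>C \<inter> {s<..<t}. 0 \<le> sdiff h k"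
  define f where "f k = (if k \<in> {s..t} then h k else g k)" for k
  have "(\<Sum>k=a..b. (w k - g k) * (f k - g k)) \<le> 0"
  proof (rule is_projD(3)[OF g])
    fix k assume k: "k \<in> C"
    show "0 \<le> sdiff f k"
    proof (cases "k \<in> {s<..<t}")
      case True
      then have "sdiff f k = sdiff h k" by (auto simp: sdiff_def f_def)
      then show ?thesis using h k True by auto
    next
      case False
      \<comment> \<open>The index 0 is excluded because truncated subtraction turns
        \<open>sdiff g 0\<close> into \<open>g 1 - g 0\<close>, which is not a second difference;
        the centre \<open>s - 1\<close> is meaningful only for \<open>s \<ge> 1\<close>.\<close>
      have "k \<noteq> s" "k \<noteq> t" "k \<noteq> t + 1" "k \<noteq> 0" "s \<ge> 1 \<Longrightarrow> k \<noteq> s - 1" using k C by metis+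
      with False have "k < s - 1 \<or> t + 1 < k" by (cases "s = 0"; simp; linarith)
      then have "sdiff f k = sdiff g k" by (auto simp: sdiff_def f_def)
      then show ?thesis using is_projD(2)[OF g k] by simp
    qed
  qed
  also have "(\<Sum>k=a..b. (w k - g k) * (f k - g k)) = (\<Sum>k=s..t. (w k - ?g k) * (h k - ?g k))"
    using st by (intro sum.mono_neutral_cong_right) (auto simp: f_def)
  finally show "(\<Sum>k=s..t. (w k - ?g k) * (h k - ?g k)) \<le> 0" .
qed auto

text \<open>Apart from 0, only the centres \<open>k - 1\<close>, \<open>k\<close>,
  \<open>k + 1\<close> read the coordinate \<open>k\<close>, so it can be replaced by its data
  value; testing with that replacement leaves a single square.\<close>

lemma is_proj_free_coordinate:
  assumes g: "is_proj C a b w g" and k: "k \<in> {a..b}"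
    and C: "k - 1 \<notin> C" "k \<notin> C" "k + 1 \<notin> C" "0 \<notin> C"
  shows "g k = w k"
proof -
  have "(\<Sum>j=a..b. (w j - g j) * ((g(k := w k)) j - g j)) \<le> 0"
  proof (rule is_projD(3)[OF g])
    fix j assume j: "j \<in> C"
    then have "j \<noteq> k - 1" "j \<noteq> k" "j \<noteq> k + 1" "j \<noteq> 0" using C by metis+
    then have "sdiff (g(k := w k)) j = sdiff g j" by (auto simp: sdiff_def)
    then show "0 \<le> sdiff (g(k := w k)) j" using is_projD(2)[OF g j] by simp
  qed
  also have "(\<Sum>j=a..b. (w j - g j) * ((g(k := w k)) j - g j)) = (\<Sum>j\<in>{k}. (w j - g j) * ((g(k := w k)) j - g j))"
    using k by (intro sum.mono_neutral_right) auto
  finally have "(w k - g k)\<^sup>2 \<le> 0" by (simp add: power2_eq_square)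
  then show ?thesis by simp
qed

text \<open>Raising the last constrained coordinate to its data value preserves every constraint.\<close>
lemma is_proj_last_ge:
  assumes g: "is_proj C a b w g" and k: "k \<in> {a..b}"
    and C: "k \<notin> C" "k + 1 \<notin> C" "0 \<notin> C"
  shows "w k \<le> g k"
proof (rule ccontr)
  assume lt: "\<not> w k \<le> g k"
  have "(\<Sum>j=a..b. (w j - g j) * ((g(k := w k)) j - g j)) \<le> 0"
  proof (rule is_projD(3)[OF g])
    fix j assume j: "j \<in> C"
    then have "j \<noteq> k" "j \<noteq> k + 1" "j \<noteq> 0" using C by metis+
    then have "sdiff g j \<le> sdiff (g(k := w k)) j" using lt by (auto simp: sdiff_def)
    then show "0 \<le> sdiff (g(k := w k)) j" using is_projD(2)[OF g j] by simp
  qed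
  also have "(\<Sum>j=a..b. (w j - g j) * ((g(k := w k)) j - g j)) = (\<Sum>j\<in>{k}. (w j - g j) * ((g(k := w k)) j - g j))"
    using k by (intro sum.mono_neutral_right) auto
  finally have "(w k - g k)\<^sup>2 \<le> 0" by (simp add: power2_eq_square)
  then show False using lt by simp
qed

section \<open>Localisation of the least squares estimator\<close>

text \<open>Data and candidate end at \<open>n\<close>, so the cross term in the expanded square is
  a finite sum and only the squared distance to \<open>q\<close> stays infinite. As before, this
  excess gives minimality and uniqueness together.\<close>

lemma convex_lse_eq:
  assumes q: "q \<in> convex_L2" and supp: "\<And>k. k > n \<Longrightarrow> y k = 0" "\<And>k. k > n \<Longrightarrow> q k = 0"
    and vi: "\<And>h. convex_seq h \<Longrightarrow> (\<Sum>k\<le>n. (y k - q k) * (h k - q k)) \<le> 0"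
  shows "convex_lse y = q"
proof -
  have key: "summable (\<lambda>j. (h j - q j)\<^sup>2) \<and> ls_obj y q + 1/2 * (\<Sum>j. (h j - q j)\<^sup>2) \<le> ls_obj y h"
    if h: "h \<in> convex_L2" for h
  proof -
    \<comment> \<open>Changing finitely many terms of \<open>h\<close> preserves square summability,
      so the infinite sums below are genuine.\<close>
    have "eventually (\<lambda>j. (h j - q j)\<^sup>2 = (h j)\<^sup>2) sequentially"
      using eventually_gt_at_top[of n] by eventually_elim (simp add: supp)
    then have sm: "summable (\<lambda>j. (h j - q j)\<^sup>2)"
      using h summable_cong[of "\<lambda>j. (h j - q j)\<^sup>2" "\<lambda>j. (h j)\<^sup>2"] by (auto simp: convex_L2_def)
    have s1: "(\<lambda>j. (y j - q j)\<^sup>2) sums (\<Sum>j\<le>n. (y j - q j)\<^sup>2)"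
      by (rule sums_finite) (auto simp: supp)
    have s2: "(\<lambda>j. (y j - q j) * (h j - q j)) sums (\<Sum>j\<le>n. (y j - q j) * (h j - q j))"
      by (rule sums_finite) (auto simp: supp)
    have "(\<lambda>j. (y j - q j)\<^sup>2 - 2 * ((y j - q j) * (h j - q j)) + (h j - q j)\<^sup>2) sums
      ((\<Sum>j\<le>n. (y j - q j)\<^sup>2) - 2 * (\<Sum>j\<le>n. (y j - q j) * (h j - q j)) + (\<Sum>j. (h j - q j)\<^sup>2))"
      by (intro sums_add sums_diff sums_mult s1 s2 summable_sums sm)
    also have "(\<lambda>j. (y j - q j)\<^sup>2 - 2 * ((y j - q j) * (h j - q j)) + (h j - q j)\<^sup>2) = (\<lambda>j. (y j - h j)\<^sup>2)"
      by (simp add: fun_eq_iff power2_eq_square algebra_simps)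
    finally have "(\<Sum>j. (y j - h j)\<^sup>2) =
      (\<Sum>j\<le>n. (y j - q j)\<^sup>2) - 2 * (\<Sum>j\<le>n. (y j - q j) * (h j - q j)) + (\<Sum>j. (h j - q j)\<^sup>2)"
      by (simp add: sums_iff)
    moreover have "(\<Sum>j. (y j - q j)\<^sup>2) = (\<Sum>j\<le>n. (y j - q j)\<^sup>2)" using s1 by (simp add: sums_iff)
    moreover have "(\<Sum>j\<le>n. (y j - q j) * (h j - q j)) \<le> 0" using vi h by (simp add: convex_L2_def)
    ultimately show ?thesis using sm by (simp add: ls_obj_def)
  qed
  show ?thesis unfolding convex_lse_def
  proof (rule the_equality)
    show "q \<in> convex_L2 \<and> (\<forall>h\<in>convex_L2. ls_obj y q \<le> ls_obj y h)"
    proof (intro conjI ballI q)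
      fix h assume "h \<in> convex_L2"
      from key[OF this] suminf_nonneg[of "\<lambda>j. (h j - q j)\<^sup>2"] show "ls_obj y q \<le> ls_obj y h" by simp
    qed
    fix h assume h: "h \<in> convex_L2 \<and> (\<forall>f\<in>convex_L2. ls_obj y h \<le> ls_obj y f)"
    then have "ls_obj y h \<le> ls_obj y q" using q by blast
    with key[of h] h have sm: "summable (\<lambda>j. (h j - q j)\<^sup>2)" and "(\<Sum>j. (h j - q j)\<^sup>2) \<le> 0" by auto
    then have "(\<Sum>j. (h j - q j)\<^sup>2) = 0" using suminf_nonneg[OF sm] by simp
    then have "\<forall>j. (h j - q j)\<^sup>2 = 0" using suminf_eq_zero_iff[OF sm] by simp
    then show "h = q" by (simp add: fun_eq_iff)
  qed
qed

section \<open>Small perturbations of a convex sequence with finite support\<close>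

locale convex_finite_support =
  fixes p :: "nat \<Rightarrow> real" and S :: nat
  assumes S_pos: "S \<ge> 1" and conv: "convex_seq p"
    and pos: "k \<le> S \<Longrightarrow> p k > 0" and zero: "k > S \<Longrightarrow> p k = 0"
begin

text \<open>The active constraints of \<open>p\<close>. The point \<open>S + 1\<close> is left out
  because it is always a knot (\<open>knot_last\<close>).\<close>

definition flat :: "nat set" where
  "flat = {k. 1 \<le> k \<and> k \<le> S \<and> sdiff p k = 0}"

lemma sdiff_nonneg: "1 \<le> k \<Longrightarrow> 0 \<le> sdiff p k"
  using conv by (simp add: convex_seq_def)

lemma sdiff_beyond: "k \<ge> S + 2 \<Longrightarrow> sdiff p k = 0"
  by (simp add: sdiff_def zero)

lemma knot_last: "knot p (S + 1)"
  by (simp add: knot_def sdiff_def zero pos)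

lemma knot_le: "knot p k \<Longrightarrow> k \<le> S + 1"
  using sdiff_beyond[of k] by (cases "S + 2 \<le> k") (auto simp: knot_def)

lemma knot_not_flat: "knot p k \<Longrightarrow> k \<notin> flat"
  by (auto simp: knot_def flat_def)

lemma not_flat_beyond: "k \<ge> S + 1 \<Longrightarrow> k \<notin> flat"
  by (auto simp: flat_def)

lemma zero_not_flat: "0 \<notin> flat"
  by (simp add: flat_def)

lemma flat_iff: "k \<in> flat \<longleftrightarrow> 1 \<le> k \<and> k \<le> S \<and> \<not> knot p k"
  using sdiff_nonneg[of k] by (auto simp: flat_def knot_def)

text \<open>There are finitely many knots, none beyond \<open>S + 1\<close>, and at least one, so
  the least second difference over them is positive.\<close>

lemma knot_slack: obtains e where "e > 0" "\<And>k. knot p k \<Longrightarrow> sdiff p k \<ge> e"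
proof
  let ?N = "{k. knot p k}"
  have "?N \<subseteq> {..S+1}" using knot_le by auto
  then have fin: "finite ?N" by (rule finite_subset) simp
  have ne: "?N \<noteq> {}" using knot_last by blast
  show "Min (sdiff p ` ?N) > 0" using fin ne by (auto simp: knot_def)
  show "sdiff p k \<ge> Min (sdiff p ` ?N)" if "knot p k" for k using fin that by auto
qed

text \<open>The weights 1, 2, 1 add up to 4, so a perturbation of size \<open>e / 4\<close> changes
  a second difference by at most \<open>e\<close>, the slack at a knot. At a flat point
  \<open>p\<close> contributes 0 and the sign of \<open>sdiff g\<close> decides.\<close>

lemma sdiff_perturb:
  assumes e: "\<And>k. knot p k \<Longrightarrow> sdiff p k \<ge> e" and g: "\<And>k. \<bar>g k\<bar> \<le> e / 4"
    and k: "1 \<le> k" "k \<le> S + 1" "k \<in> flat \<Longrightarrow> 0 \<le> sdiff g k"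
  shows "0 \<le> sdiff (\<lambda>k. p k + g k) k"
proof (cases "k \<in> flat")
  case True
  then show ?thesis using k by (simp add: sdiff_add flat_def)
next
  case False
  then have "knot p k" using k knot_last by (cases "k = S + 1") (auto simp: flat_iff)
  moreover have "sdiff g k \<ge> - e"
    using g[of "k+1"] g[of k] g[of "k-1"] unfolding sdiff_def by linarith
  ultimately show ?thesis using e[of k] by (simp add: sdiff_add)
qed

lemma convex_lse_perturb:
  assumes y: "\<And>k. k > S \<Longrightarrow> y k = 0"
    and g: "is_proj flat 0 (S + 1) (\<lambda>k. y k - p k) g"
    and e: "\<And>k. knot p k \<Longrightarrow> sdiff p k \<ge> e" "\<And>k. \<bar>g k\<bar> \<le> e / 4"
  shows "convex_lse y = (\<lambda>k. p k + g k)"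
proof (rule convex_lse_eq[where n = "S + 1"])
  \<comment> \<open>This sign is the convexity constraint at \<open>S + 2\<close>: there the second
    difference of the candidate equals \<open>g (S + 1)\<close>.\<close>
  have last: "0 \<le> g (S + 1)"
    using is_proj_last_ge[OF g, of "S+1"] y zero by (simp add: flat_def)
  have out: "g k = 0" if "k > S + 1" for k using is_projD(1)[OF g] that by simp
  have "0 \<le> sdiff (\<lambda>k. p k + g k) k" if k: "1 \<le> k" for k
  proof (cases "k \<le> S + 1")
    case True
    show ?thesis by (rule sdiff_perturb[OF e k True is_projD(2)[OF g]])
  next
    case False
    then have "k = S + 2 \<or> k > S + 2" by linarith
    then show ?thesis using last by (auto simp: sdiff_def out zero)
  qed
  moreover have "summable (\<lambda>k. (p k + g k)\<^sup>2)"
    by (rule summable_finite[of "{..S+1}"]) (auto simp: out zero)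
  ultimately show "(\<lambda>k. p k + g k) \<in> convex_L2"
    by (simp add: convex_L2_def convex_seq_def)
  show "(\<Sum>k\<le>S + 1. (y k - (p k + g k)) * (h k - (p k + g k))) \<le> 0" if h: "convex_seq h" for h
  proof -
    have "(\<Sum>k=0..S + 1. (y k - p k - g k) * (h k - p k - g k)) \<le> 0"
    proof (rule is_projD(3)[OF g])
      \<comment> \<open>As \<open>sdiff p\<close> vanishes on \<open>flat\<close>, subtracting
        \<open>p\<close> turns a convex competitor into an admissible one for the
        projection.\<close>
      fix k assume "k \<in> flat"
      then show "0 \<le> sdiff (\<lambda>k. h k - p k) k"
        using h by (simp add: sdiff_diff convex_seq_def flat_def)
    qed
    then show ?thesis by (simp add: atMost_atLeast0 diff_diff_eq)
  qed
qed (auto simp: y zero is_projD(1)[OF g])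

text \<open>The windowed analogue of \<open>convex_lse_perturb\<close>. The hypotheses
  \<open>last\<close> supply convexity at centres beyond \<open>S + 1\<close>, which the window may
  contain.\<close>

lemma convex_on_range_argmin_perturb:
  assumes g: "is_proj (flat \<inter> {z<..<z'}) z z' (\<lambda>k. y k - p k) g"
    and e: "\<And>k. knot p k \<Longrightarrow> sdiff p k \<ge> e" "\<And>k. \<bar>g k\<bar> \<le> e / 4"
    and last: "0 \<le> g (S + 1)" "\<And>k. k > S + 1 \<Longrightarrow> g k = 0"
  shows "sq_argmin (\<lambda>g. convex_on_range g z z') z z' y = (\<lambda>k. if k \<in> {z..z'} then p k + g k else 0)"
    (is "_ = ?f")
proof (rule sq_argmin_eq[where C = "{z<..<z'}"])
  show "convex_on_range h z z' = (\<forall>k\<in>{z<..<z'}. 0 \<le> sdiff h k)" for h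
    by (auto simp: convex_on_range_def)
  show "is_proj {z<..<z'} z z' y ?f"
    unfolding is_proj_def
  proof (intro conjI allI impI ballI)
    fix k assume k: "k \<in> {z<..<z'}"
    then have k1: "1 \<le> k" by auto
    have "sdiff ?f k = sdiff (\<lambda>k. p k + g k) k" using k by (auto simp: sdiff_def)
    also have "\<dots> \<ge> 0"
    proof (cases "k \<le> S + 1")
      case True
      show ?thesis using is_projD(2)[OF g] k by (intro sdiff_perturb[OF e k1 True]) auto
    next
      case False
      then have "k = S + 2 \<or> k > S + 2" by linarith
      then show ?thesis using last(1) by (auto simp: sdiff_def last(2) zero)
    qed
    finally show "0 \<le> sdiff ?f k" .
  next
    fix h assume h: "\<forall>k\<in>{z<..<z'}. 0 \<le> sdiff h k"
    have "(\<Sum>k=z..z'. (y k - p k - g k) * (h k - p k - g k)) \<le> 0"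
    proof (rule is_projD(3)[OF g])
      fix k assume "k \<in> flat \<inter> {z<..<z'}"
      then show "0 \<le> sdiff (\<lambda>k. h k - p k) k"
        using h by (simp add: sdiff_diff flat_def)
    qed
    then show "(\<Sum>k=z..z'. (y k - ?f k) * (h k - ?f k)) \<le> 0" by (simp add: diff_diff_eq)
  qed auto
qed

section \<open>Pieces between knots and blocks between double knots\<close>

definition piece_points :: "nat \<Rightarrow> nat \<Rightarrow> nat set" where
  "piece_points z z' = {k. \<exists>a\<in>ext_knots p S. \<exists>b\<in>ext_knots p S. a < k \<and> k < b \<and>
     (\<forall>c\<in>ext_knots p S. \<not> (a < c \<and> c < b)) \<and> z \<le> a \<and> b \<le> z'}"

lemma piecewise_convex_iff: "piecewise_convex p S z z' g \<longleftrightarrow> (\<forall>k\<in>piece_points z z'. 0 \<le> sdiff g k)"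
  unfolding piecewise_convex_def convex_on_range_def piece_points_def
  by (auto; metis order.strict_trans)

text \<open>The inclusion can be strict: a piece that sticks out of the window imposes no
  constraint.\<close>

lemma piece_points_subset: "piece_points z z' \<subseteq> flat \<inter> {z<..<z'}"
proof
  fix k assume "k \<in> piece_points z z'"
  then obtain a b where ab: "a \<in> ext_knots p S" "b \<in> ext_knots p S" "a < k" "k < b" "z \<le> a" "b \<le> z'"
    and c: "\<forall>c\<in>ext_knots p S. \<not> (a < c \<and> c < b)" by (auto simp: piece_points_def)
  have "b \<le> S + 1" using ab(2) by (auto simp: ext_knots_def)
  moreover have "k \<notin> ext_knots p S" using ab c by blast
  ultimately show "k \<in> flat \<inter> {z<..<z'}" using ab by (auto simp: flat_iff ext_knots_def)
qed

text \<open>The extended knots nearest to \<open>k\<close> on either side cannot lie beyond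
  \<open>s\<close> or \<open>t\<close>, which are extended knots themselves; hence the piece around
  \<open>k\<close> is inside the window.\<close>

lemma piece_pointsI:
  assumes k: "k \<in> flat" "s < k" "k < t" and st: "s \<in> ext_knots p S" "t \<in> ext_knots p S" "z \<le> s" "t \<le> z'"
  shows "k \<in> piece_points z z'"
proof -
  let ?E = "ext_knots p S"
  have fin: "finite ?E" by (simp add: ext_knots_def)
  have kE: "k \<notin> ?E" using k(1) by (auto simp: flat_iff ext_knots_def)
  define a where "a = Max {c\<in>?E. c < k}"
  define b where "b = Min {c\<in>?E. k < c}"
  have a: "a \<in> {c\<in>?E. c < k}" unfolding a_def using fin st k by (intro Max_in) auto
  have b: "b \<in> {c\<in>?E. k < c}" unfolding b_def using fin st k by (intro Min_in) auto
  have sa: "s \<le> a" unfolding a_def using fin st k by (intro Max_ge) auto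
  have bt: "b \<le> t" unfolding b_def using fin st k by (intro Min_le) auto
  have "\<not> (a < c \<and> c < b)" if c: "c \<in> ?E" for c
  proof
    assume ac: "a < c \<and> c < b"
    have "c \<noteq> k" using kE c by auto
    then consider "c < k" | "k < c" by linarith
    then show False
    proof cases
      case 1
      then have "c \<le> a" unfolding a_def using fin c by (intro Max_ge) auto
      then show False using ac by simp
    next
      case 2
      then have "b \<le> c" unfolding b_def using fin c by (intro Min_le) auto
      then show False using ac by simp
    qed
  qed
  then show ?thesis using a b sa bt st unfolding piece_points_def
    by (intro CollectI bexI[of _ a] bexI[of _ b]) auto
qed

text \<open>On the left the separating pair is \<open>s - 1, s\<close>, on the right
  \<open>t, t + 1\<close>. At the extreme ends 0 and \<open>S + 1\<close> the indices in question
  lie outside \<open>{1..S}\<close>.\<close>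

lemma flat_decouples:
  assumes "s = 0 \<or> (s \<ge> 1 \<and> double_knot p (s - 1))" "double_knot p t \<or> t = S + 1"
  shows "s \<ge> 1 \<Longrightarrow> s - 1 \<notin> flat" "s \<notin> flat" "t \<notin> flat" "t + 1 \<notin> flat"
  using assms knot_not_flat zero_not_flat not_flat_beyond by (auto simp: double_knot_def)

lemma is_proj_on_block:
  assumes g: "is_proj C a b w g" and C: "C \<subseteq> flat" "flat \<inter> {s<..<t} \<subseteq> C"
    and ab: "a \<le> s" "t \<le> b"
    and st: "s = 0 \<or> (s \<ge> 1 \<and> double_knot p (s - 1))" "double_knot p t \<or> t = S + 1"
  shows "is_proj (flat \<inter> {s<..<t}) s t w (\<lambda>k. if k \<in> {s..t} then g k else 0)"
proof -
  have "flat \<inter> {s<..<t} = C \<inter> {s<..<t}" using C by blast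
  then show ?thesis
    using is_proj_restrict[OF g ab] flat_decouples[OF st] C(1) zero_not_flat by (auto simp: subset_iff)
qed

text \<open>Both projections restrict to the projection for the block, which is unique. Windows and
  constraints may differ away from the block, and this is why \<open>z\<close> and \<open>z'\<close>
  are arbitrary.\<close>

lemma is_proj_agree:
  assumes g: "is_proj C a b w g" and C: "C \<subseteq> flat" "flat \<inter> {s<..<t} \<subseteq> C" and ab: "a \<le> s" "t \<le> b"
    and h: "is_proj C' a' b' w h" and C': "C' \<subseteq> flat" "flat \<inter> {s<..<t} \<subseteq> C'" and ab': "a' \<le> s" "t \<le> b'"
    and st: "s = 0 \<or> (s \<ge> 1 \<and> double_knot p (s - 1))" "double_knot p t \<or> t = S + 1"
    and k: "k \<in> {s..t}"
  shows "g k = h k"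
  using fun_cong[OF is_proj_unique[OF is_proj_on_block[OF g C ab st] is_proj_on_block[OF h C' ab' st]], of k] k
  by simp

text \<open>The claim starts at \<open>S + 2\<close> because a constraint centred at
  \<open>S\<close> still reads the coordinate \<open>S + 1\<close>.\<close>

lemma is_proj_beyond:
  assumes g: "is_proj C a b w g" and C: "C \<subseteq> flat" and k: "k > S + 1" and w: "w k = 0"
  shows "g k = 0"
proof (cases "k \<in> {a..b}")
  case True
  have "k - 1 \<notin> C" "k \<notin> C" "k + 1 \<notin> C" "0 \<notin> C"
    using C k not_flat_beyond zero_not_flat by auto
  from is_proj_free_coordinate[OF g True this] w show ?thesis by simp
qed (use is_projD(1)[OF g] in auto)

lemma is_proj_last_nonneg:
  assumes g: "is_proj C a b w g" and C: "C \<subseteq> flat" and w: "w (S + 1) = 0"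
  shows "0 \<le> g (S + 1)"
proof (cases "S + 1 \<in> {a..b}")
  case True
  have "S + 1 \<notin> C" "S + 1 + 1 \<notin> C" "0 \<notin> C"
    using C not_flat_beyond zero_not_flat by auto
  from is_proj_last_ge[OF g True this] w show ?thesis by simp
qed (use is_projD(1)[OF g] in auto)

text \<open>Comparison with the projection of zero data. The bound is the same for every window,
  since the data live on \<open>S + 1\<close> points.\<close>

lemma is_proj_bound:
  assumes g: "is_proj C a b w g" and w: "\<And>k. k > S \<Longrightarrow> w k = 0" "\<And>k. k \<le> S \<Longrightarrow> \<bar>w k\<bar> \<le> d" and d: "d \<ge> 0"
  shows "\<bar>g k\<bar> \<le> real (S + 1) * d"
proof -
  have "\<bar>g k - 0\<bar> \<le> L2_set (\<lambda>k. w k - 0) {a..b}" by (rule is_proj_lipschitz[OF g is_proj_zero])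
  also have "\<dots> \<le> (\<Sum>k\<in>{a..b}. \<bar>w k\<bar>)" using L2_set_le_sum_abs[of w "{a..b}"] by simp
  also have "\<dots> = (\<Sum>k\<in>{a..b} \<inter> {..S}. \<bar>w k\<bar>)" by (intro sum.mono_neutral_right) (auto simp: w)
  also have "\<dots> \<le> (\<Sum>k\<le>S. \<bar>w k\<bar>)" by (intro sum_mono2) auto
  also have "\<dots> \<le> (\<Sum>k\<le>S. d)" by (intro sum_mono) (auto simp: w)
  finally show ?thesis by simp
qed

theorem convex_lse_local:
  assumes s: "s = 0 \<or> (s \<ge> 1 \<and> double_knot p (s - 1))"
    and s': "double_knot p s' \<or> s' \<ge> S + 1" and z: "z \<le> s" "s \<le> s'" "s' \<le> z'"
  obtains d where "d > 0" and
    "\<And>y k. (\<And>j. j > S \<Longrightarrow> y j = 0) \<Longrightarrow> (\<And>j. j \<le> S \<Longrightarrow> \<bar>y j - p j\<bar> \<le> d) \<Longrightarrow> k \<in> {s..s'} \<Longrightarrow>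
       convex_lse y k = sq_argmin (\<lambda>g. convex_on_range g z z') z z' y k"
    "\<And>y k. (\<And>j. j > S \<Longrightarrow> y j = 0) \<Longrightarrow> (\<And>j. j \<le> S \<Longrightarrow> \<bar>y j - p j\<bar> \<le> d) \<Longrightarrow> k \<in> {s..s'} \<Longrightarrow>
       convex_lse y k - p k = sq_argmin (piecewise_convex p S z z') z z' (\<lambda>j. y j - p j) k"
proof -
  obtain e where e: "e > 0" "\<And>k. knot p k \<Longrightarrow> sdiff p k \<ge> e" using knot_slack by blast
  \<comment> \<open>At most \<open>S + 1\<close> nonzero data coordinates of size \<open>d\<close>
    amount to \<open>e / 4\<close>, the tolerance of \<open>sdiff_perturb\<close>.\<close>
  define d where "d = e / (4 * real (S + 1))"
  have d: "d > 0" "real (S + 1) * d = e / 4" using e(1) by (auto simp: d_def divide_simps)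
  \<comment> \<open>The block ends at \<open>S + 1\<close> at the latest; further right all three
    projections below vanish.\<close>
  define t where "t = min s' (S + 1)"
  have sS: "s \<le> S + 1" using s knot_le[of s] by (auto simp: double_knot_def)
  have t: "double_knot p t \<or> t = S + 1"
    using s' knot_le[of s'] by (auto simp: double_knot_def t_def min_def)
  have sE: "s \<in> ext_knots p S" using s sS by (auto simp: ext_knots_def double_knot_def)
  have tE: "t \<in> ext_knots p S" using t by (auto simp: ext_knots_def double_knot_def knot_def t_def min_def)
  have tt: "t \<le> S + 1" "t \<le> s'" "s \<le> t" "t \<le> z'" using sS z by (auto simp: t_def)
  let ?P = "piece_points z z'" and ?F = "flat \<inter> {z<..<z'}"
  have main: "convex_lse y k = sq_argmin (\<lambda>g. convex_on_range g z z') z z' y k \<and>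
      convex_lse y k - p k = sq_argmin (piecewise_convex p S z z') z z' (\<lambda>j. y j - p j) k"
    if y: "\<And>j. j > S \<Longrightarrow> y j = 0" "\<And>j. j \<le> S \<Longrightarrow> \<bar>y j - p j\<bar> \<le> d" and k: "k \<in> {s..s'}" for y k
  proof -
    let ?w = "\<lambda>j. y j - p j"
    have w0: "?w j = 0" if "j > S" for j using that by (simp add: y zero)
    \<comment> \<open>All three project the same data \<open>y - p\<close>: \<open>f\<close> is the
      error of the estimator, \<open>g\<close> that of the windowed convex fit, \<open>h\<close> the
      solution of the limiting type of problem.\<close>
    obtain f where f: "is_proj flat 0 (S + 1) ?w f"
      using is_proj_exists[of flat 0 "S+1" ?w] by (auto simp: subset_iff flat_iff)
    obtain g where g: "is_proj ?F z z' ?w g" using is_proj_exists[of ?F z z' ?w] by auto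
    obtain h where h: "is_proj ?P z z' ?w h"
      using is_proj_exists[of ?P z z' ?w] piece_points_subset[of z z'] by auto
    have bf: "\<bar>f k\<bar> \<le> e / 4" and bg: "\<bar>g k\<bar> \<le> e / 4" for k
      using is_proj_bound[OF f w0, of d k] is_proj_bound[OF g w0, of d k] y(2) d by auto
    have lse: "convex_lse y = (\<lambda>k. p k + f k)"
      by (rule convex_lse_perturb[OF y(1) f e(2) bf])
    have range: "sq_argmin (\<lambda>g. convex_on_range g z z') z z' y = (\<lambda>k. if k \<in> {z..z'} then p k + g k else 0)"
    proof (rule convex_on_range_argmin_perturb[OF g e(2) bg])
      show "0 \<le> g (S + 1)" by (rule is_proj_last_nonneg[OF g]) (use w0 in auto)
      show "g j = 0" if "j > S + 1" for j by (rule is_proj_beyond[OF g _ that]) (use w0 that in auto)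
    qed
    have piece: "sq_argmin (piecewise_convex p S z z') z z' ?w = h"
      by (rule sq_argmin_eq[OF piecewise_convex_iff h])
    have P: "?P \<subseteq> flat" "flat \<inter> {s<..<t} \<subseteq> ?P"
      using piece_points_subset[of z z'] piece_pointsI[OF _ _ _ sE tE] z tt by auto
    have F: "?F \<subseteq> flat" "flat \<inter> {s<..<t} \<subseteq> ?F" using z tt by auto
    have "f k = g k \<and> f k = h k"
    proof (cases "k \<le> t")
      case True
      then have kt: "k \<in> {s..t}" using k by simp
      have "f k = g k"
        by (rule is_proj_agree[OF f _ _ _ _ g F _ _ s t kt]) (use z tt in auto)
      moreover have "f k = h k"
        by (rule is_proj_agree[OF f _ _ _ _ h P _ _ s t kt]) (use z tt in auto)
      ultimately show ?thesis by simp
    next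
      case False
      then have kS: "k > S + 1" using k by (auto simp: t_def)
      have wk: "?w k = 0" using w0[of k] kS by simp
      show ?thesis
        using is_proj_beyond[OF f order_refl kS wk] is_proj_beyond[OF g F(1) kS wk]
          is_proj_beyond[OF h P(1) kS wk] by simp
    qed
    moreover have "k \<in> {z..z'}" using k z by auto
    ultimately show ?thesis unfolding lse range piece by simp
  qed
  show thesis by (rule that[OF d(1)]) (use main in blast)+
qed

end

section \<open>The Cramer-Wold device\<close>

text \<open>The linear span of the test functions controlled by one-dimensional projections: a
  generator sees \<open>x\<close> through one linear form only. The phase \<open>b\<close> makes
  sines available too.\<close>

inductive_set trig :: "nat \<Rightarrow> ((nat \<Rightarrow> real) \<Rightarrow> real) set" for m :: nat where
  cos: "(\<lambda>x. cos ((\<Sum>i\<le>m. a i * x i) + b)) \<in> trig m"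
| scale: "f \<in> trig m \<Longrightarrow> (\<lambda>x. c * f x) \<in> trig m"
| add: "f \<in> trig m \<Longrightarrow> g \<in> trig m \<Longrightarrow> (\<lambda>x. f x + g x) \<in> trig m"

lemma trig_const: "(\<lambda>x. c) \<in> trig m"
  using trig.scale[OF trig.cos[of "\<lambda>_. 0" m 0], of c] by simp

text \<open>By the product-to-sum formula frequencies and phases are added and subtracted, so
  products stay in the span; this provides the algebra for Stone-Weierstrass.\<close>

lemma trig_cos_mult:
  assumes "g \<in> trig m"
  shows "(\<lambda>x. cos ((\<Sum>i\<le>m. a i * x i) + b) * g x) \<in> trig m"
  using assms
proof induction
  case (cos a' b')
  have "(\<lambda>x. cos ((\<Sum>i\<le>m. a i * x i) + b) * cos ((\<Sum>i\<le>m. a' i * x i) + b')) =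
    (\<lambda>x. 1/2 * cos ((\<Sum>i\<le>m. (a i - a' i) * x i) + (b - b')) + 1/2 * cos ((\<Sum>i\<le>m. (a i + a' i) * x i) + (b + b')))"
  proof
    fix x :: "nat \<Rightarrow> real"
    have "(\<Sum>i\<le>m. (a i - a' i) * x i) + (b - b') = ((\<Sum>i\<le>m. a i * x i) + b) - ((\<Sum>i\<le>m. a' i * x i) + b')"
      "(\<Sum>i\<le>m. (a i + a' i) * x i) + (b + b') = ((\<Sum>i\<le>m. a i * x i) + b) + ((\<Sum>i\<le>m. a' i * x i) + b')"
      by (simp_all add: sum_subtractf sum.distrib algebra_simps)
    then show "cos ((\<Sum>i\<le>m. a i * x i) + b) * cos ((\<Sum>i\<le>m. a' i * x i) + b') =
      1/2 * cos ((\<Sum>i\<le>m. (a i - a' i) * x i) + (b - b')) + 1/2 * cos ((\<Sum>i\<le>m. (a i + a' i) * x i) + (b + b'))"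
      by (simp only: cos_times_cos) (simp add: field_simps)
  qed
  then show ?case by (simp only: trig.intros)
next
  case (scale f c)
  then show ?case using trig.scale[OF scale.IH, of c] by (simp add: mult.left_commute)
next
  case (add f g)
  then show ?case using trig.add[OF add.IH] by (simp add: distrib_left)
qed

lemma trig_mult: "f \<in> trig m \<Longrightarrow> g \<in> trig m \<Longrightarrow> (\<lambda>x. f x * g x) \<in> trig m"
proof (induction rule: trig.induct)
  case (cos a b)
  then show ?case by (rule trig_cos_mult)
next
  case (scale f c)
  then show ?case using trig.scale[of "\<lambda>x. f x * g x" m c] by (simp add: mult.assoc)
next
  case (add f h)
  then show ?case using trig.add[of "\<lambda>x. f x * g x" m "\<lambda>x. h x * g x"] by (simp add: distrib_right)
qed

lemma trig_sin_coordinate: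
  assumes "k \<le> m"
  shows "(\<lambda>x. sin (c * x k)) \<in> trig m"
proof -
  have "sin (c * x k) = cos ((\<Sum>i\<le>m. (if i = k then c else 0) * x i) + (- (pi/2)))" for x :: "nat \<Rightarrow> real"
  proof -
    have "(\<Sum>i\<le>m. (if i = k then c else 0) * x i) = (\<Sum>i\<le>m. if i = k then c * x i else 0)"
      by (intro sum.cong) auto
    then have "(\<Sum>i\<le>m. (if i = k then c else 0) * x i) = c * x k" using assms by simp
    then show ?thesis by (simp add: cos_sin_eq)
  qed
  then show ?thesis using trig.cos[of "\<lambda>i. if i = k then c else 0" m "- (pi/2)"] by simp
qed

lemma trig_continuous: "f \<in> trig m \<Longrightarrow> continuous_on UNIV f"
proof (induction rule: trig.induct)
  case (cos a b)
  then show ?case by (intro continuous_intros continuous_on_product_coordinates)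
qed (auto intro: continuous_intros)

lemma trig_bounded: "f \<in> trig m \<Longrightarrow> \<exists>B. \<forall>x. \<bar>f x\<bar> \<le> B"
proof (induction rule: trig.induct)
  case (cos a b)
  then show ?case using abs_cos_le_one by blast
next
  case (scale f c)
  then obtain B where "\<forall>x. \<bar>f x\<bar> \<le> B" by blast
  then have "\<forall>x. \<bar>c * f x\<bar> \<le> \<bar>c\<bar> * B" by (simp add: abs_mult mult_left_mono)
  then show ?case by blast
next
  case (add f g)
  then obtain B C where "\<forall>x. \<bar>f x\<bar> \<le> B" "\<forall>x. \<bar>g x\<bar> \<le> C" by blast
  then have "\<forall>x. \<bar>f x + g x\<bar> \<le> B + C" by (meson abs_triangle_ineq add_mono order_trans)
  then show ?case by blast
qed

text \<open>The substitution \<open>s k = sin (pi * x k / (2 * L))\<close> turns polynomial approximation on the cube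
  into approximation by trigonometric sums that is uniform on the box of radius \<open>L\<close> and stays
  bounded outside it.\<close>
lemma trig_approx:
  fixes f :: "(nat \<Rightarrow> real) \<Rightarrow> real"
  assumes f: "continuous_on UNIV f" "\<And>x. \<bar>f x\<bar> \<le> B" and L: "L > 0" and e: "e > 0"
  obtains T where "T \<in> trig m" "\<And>x. \<bar>T x\<bar> \<le> B + e"
    "\<And>x. (\<And>k. k \<le> m \<Longrightarrow> \<bar>x k\<bar> \<le> L) \<Longrightarrow> (\<And>k. k > m \<Longrightarrow> x k = 0) \<Longrightarrow> \<bar>f x - T x\<bar> \<le> e"
proof -
  \<comment> \<open>Scales \<open>{-L..L}\<close> to \<open>{-pi/2..pi/2}\<close>, where
    \<open>arcsin\<close> inverts \<open>sin\<close>.\<close>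
  define c where "c = pi / (2 * L)"
  have c: "c > 0" using L by (simp add: c_def)
  \<comment> \<open>Coordinates beyond \<open>m\<close> are pinned at 0, so that the first ones
    separate the points of \<open>Q\<close>.\<close>
  define Q :: "(nat \<Rightarrow> real) set" where "Q = {s. \<forall>k. s k \<in> (if k \<le> m then {-1..1} else {0})}"
  define \<phi> where "\<phi> x = (\<lambda>k. if k \<le> m then sin (c * x k) else 0)" for x :: "nat \<Rightarrow> real"
  define F where "F s = f (\<lambda>k. arcsin (s k) / c)" for s :: "nat \<Rightarrow> real"
  have Q1: "s k \<in> {-1..1}" if "s \<in> Q" for s k
  proof (cases "k \<le> m")
    case True
    have "s k \<in> (if k \<le> m then {-1..1} else {0})" using that unfolding Q_def by blast
    then show ?thesis using True by simp
  next
    case False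
    have "s k \<in> (if k \<le> m then {-1..1} else {0})" using that unfolding Q_def by blast
    then show ?thesis using False by simp
  qed
  have Q0: "s k = 0" if "s \<in> Q" "k > m" for s k
  proof -
    have "s k \<in> (if k \<le> m then {-1..1} else {0})" using that unfolding Q_def by blast
    then show ?thesis using that by simp
  qed
  have coord: "continuous_on Q (\<lambda>s. s k)" for k
    by (rule continuous_on_subset[OF continuous_on_product_coordinates]) auto
  have "continuous_on Q (\<lambda>s. (\<lambda>k. arcsin (s k) / c))"
    by (intro continuous_on_coordinatewise_then_product continuous_intros coord) (use Q1 c in force)+
  then have FQ: "continuous_on Q F"
    unfolding F_def by (intro continuous_on_compose2[OF f(1)]) auto
  \<comment> \<open>The functions on the cube whose pullback along \<open>\<phi>\<close> is a
    trigonometric sum. Coordinates belong to it because they pull back to sines.\<close>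
  define P where "P h \<longleftrightarrow> continuous_on Q h \<and> (\<lambda>x. h (\<phi> x)) \<in> trig m" for h :: "(nat \<Rightarrow> real) \<Rightarrow> real"
  have "\<exists>g. P g \<and> (\<forall>s\<in>Q. \<bar>F s - g s\<bar> < e)"
  proof (rule Stone_Weierstrass_HOL)
    show "compact Q" unfolding Q_def by (rule compact_box) auto
    show "P (\<lambda>x. c)" for c unfolding P_def using trig_const by (auto intro: continuous_intros)
    show "continuous_on Q h" if "P h" for h using that by (simp add: P_def)
    show "P (\<lambda>x. g x + h x)" if "P g \<and> P h" for g h
      using that unfolding P_def by (auto intro: continuous_intros trig.add)
    show "P (\<lambda>x. g x * h x)" if "P g \<and> P h" for g h
      using that unfolding P_def by (auto intro: continuous_intros trig_mult)
    show "\<exists>h. P h \<and> h x \<noteq> h y" if xy: "x \<in> Q \<and> y \<in> Q \<and> x \<noteq> y" for x y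
    proof -
      obtain k where k: "x k \<noteq> y k" using xy by blast
      then have "k \<le> m" using Q0[of x k] Q0[of y k] xy by (cases "k \<le> m") auto
      then have "P (\<lambda>s. s k)" unfolding P_def \<phi>_def using coord trig_sin_coordinate by simp
      then show ?thesis using k by blast
    qed
  qed (use FQ e in auto)
  then obtain g where g: "P g" "\<And>s. s \<in> Q \<Longrightarrow> \<bar>F s - g s\<bar> < e" by blast
  have \<phi>Q: "\<phi> x \<in> Q" for x by (auto simp: \<phi>_def Q_def)
  show thesis
  proof (rule that[of "\<lambda>x. g (\<phi> x)"])
    show "(\<lambda>x. g (\<phi> x)) \<in> trig m" using g(1) by (simp add: P_def)
    show "\<bar>g (\<phi> x)\<bar> \<le> B + e" for x
    proof -
      have "\<bar>F (\<phi> x)\<bar> \<le> B" unfolding F_def by (rule f(2))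
      then show ?thesis using g(2)[OF \<phi>Q[of x]] by linarith
    qed
    fix x :: "nat \<Rightarrow> real" assume x: "\<And>k. k \<le> m \<Longrightarrow> \<bar>x k\<bar> \<le> L" "\<And>k. k > m \<Longrightarrow> x k = 0"
    have "arcsin (\<phi> x k) / c = x k" for k
    proof (cases "k \<le> m")
      case True
      have "\<bar>c * x k\<bar> \<le> c * L" using x(1)[OF True] c by (simp add: abs_mult)
      also have "c * L = pi / 2" using L by (simp add: c_def)
      finally have "arcsin (sin (c * x k)) = c * x k" by (intro arcsin_sin) auto
      then show ?thesis using c True by (simp add: \<phi>_def)
    qed (simp add: \<phi>_def x(2))
    then have "F (\<phi> x) = f x" by (simp add: F_def)
    then show "\<bar>f x - g (\<phi> x)\<bar> \<le> e" using g(2)[OF \<phi>Q[of x]] by simp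
  qed
qed

text \<open>Continuity from above: the events that the sum of absolute values exceeds
  \<open>j\<close> decrease to the empty set.\<close>

lemma (in prob_space) tight_coordinates:
  fixes Z :: "'a \<Rightarrow> nat \<Rightarrow> real"
  assumes Z[measurable]: "\<And>k. (\<lambda>\<omega>. Z \<omega> k) \<in> borel_measurable M" and e: "e > 0"
  shows "\<exists>L. prob {\<omega> \<in> space M. \<exists>k\<le>m. \<bar>Z \<omega> k\<bar> > L} \<le> e"
proof -
  define A where "A j = {\<omega> \<in> space M. (\<Sum>k\<le>m. \<bar>Z \<omega> k\<bar>) > real j}" for j :: nat
  have A[measurable]: "A j \<in> events" for j unfolding A_def by measurable
  have "(\<lambda>j. prob (A j)) \<longlonglongrightarrow> prob (\<Inter>j. A j)"
    by (rule finite_Lim_measure_decseq) (auto simp: A_def decseq_def)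
  moreover have "(\<Inter>j. A j) = {}"
  proof -
    have "\<exists>j. \<not> real j < (\<Sum>k\<le>m. \<bar>Z \<omega> k\<bar>)" for \<omega>
      by (meson not_less real_arch_simple)
    then show ?thesis by (auto simp: A_def)
  qed
  ultimately have "eventually (\<lambda>j. prob (A j) < e) sequentially"
    using e by (simp add: order_tendsto_iff)
  then obtain j where j: "prob (A j) < e" by (auto simp: eventually_sequentially)
  have "prob {\<omega> \<in> space M. \<exists>k\<le>m. \<bar>Z \<omega> k\<bar> > real j} \<le> prob (A j)"
  proof (rule finite_measure_mono)
    show "{\<omega> \<in> space M. \<exists>k\<le>m. \<bar>Z \<omega> k\<bar> > real j} \<subseteq> A j"
    proof safe
      fix \<omega> k assume "\<omega> \<in> space M" "k \<le> m" "\<bar>Z \<omega> k\<bar> > real j"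
      moreover have "\<bar>Z \<omega> k\<bar> \<le> (\<Sum>k\<le>m. \<bar>Z \<omega> k\<bar>)"
        using \<open>k \<le> m\<close> by (intro member_le_sum) auto
      ultimately show "\<omega> \<in> A j" by (auto simp: A_def)
    qed
  qed simp
  with j show ?thesis by (intro exI[of _ "real j"]) linarith
qed

text \<open>Inside the box the error is at most \<open>e\<close>; outside it is at most
  \<open>2 * B + e\<close>, on an event of probability at most \<open>e\<close>.\<close>

lemma (in prob_space) trig_approx_expectation:
  fixes Y :: "'a \<Rightarrow> nat \<Rightarrow> real"
  assumes Y[measurable]: "Y \<in> borel_measurable M"
    and supp: "AE \<omega> in M. \<forall>k>m. Y \<omega> k = 0"
    and tight: "prob {\<omega> \<in> space M. \<exists>k\<le>m. \<bar>Y \<omega> k\<bar> > L} \<le> e"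
    and f: "continuous_on UNIV f" "\<And>x. \<bar>f x\<bar> \<le> B"
    and T: "T \<in> trig m" "\<And>x. \<bar>T x\<bar> \<le> B + e"
      "\<And>x. (\<And>k. k \<le> m \<Longrightarrow> \<bar>x k\<bar> \<le> L) \<Longrightarrow> (\<And>k. k > m \<Longrightarrow> x k = 0) \<Longrightarrow> \<bar>f x - T x\<bar> \<le> e"
    and e: "e > 0"
  shows "\<bar>expectation (\<lambda>\<omega>. f (Y \<omega>)) - expectation (\<lambda>\<omega>. T (Y \<omega>))\<bar> \<le> e + (2 * B + e) * e"
proof -
  have B: "B \<ge> 0" using f(2)[of undefined] by linarith
  have Tm: "T \<in> borel_measurable borel" and fm: "f \<in> borel_measurable borel"
    using trig_continuous[OF T(1)] f(1) by (auto intro: borel_measurable_continuous_onI)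
  note [measurable] = Tm fm
  define A where "A = {\<omega> \<in> space M. \<exists>k\<le>m. \<bar>Y \<omega> k\<bar> > L}"
  have [measurable]: "(\<lambda>\<omega>. Y \<omega> k) \<in> borel_measurable M" for k
    by (rule measurable_product_then_coordinatewise[OF Y])
  have A[measurable]: "A \<in> events" unfolding A_def by measurable
  have iT: "integrable M (\<lambda>\<omega>. T (Y \<omega>))"
    by (rule integrable_const_bound[where B = "B + e"]) (use T(2) in auto)
  have "if": "integrable M (\<lambda>\<omega>. f (Y \<omega>))"
    by (rule integrable_const_bound[where B = B]) (use f(2) in auto)
  have iA: "integrable M (indicat_real A)"
    by (rule integrable_const_bound[where B = 1]) (auto simp: indicator_def)
  have "\<bar>expectation (\<lambda>\<omega>. f (Y \<omega>)) - expectation (\<lambda>\<omega>. T (Y \<omega>))\<bar> =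
      \<bar>expectation (\<lambda>\<omega>. f (Y \<omega>) - T (Y \<omega>))\<bar>"
    using iT "if" by simp
  also have "\<dots> \<le> expectation (\<lambda>\<omega>. \<bar>f (Y \<omega>) - T (Y \<omega>)\<bar>)" by (rule integral_abs_bound)
  also have "\<dots> \<le> expectation (\<lambda>\<omega>. e + (2 * B + e) * indicat_real A \<omega>)"
  proof (rule integral_mono_AE)
    show "AE \<omega> in M. \<bar>f (Y \<omega>) - T (Y \<omega>)\<bar> \<le> e + (2 * B + e) * indicat_real A \<omega>"
      using supp AE_space
    proof eventually_elim
      case (elim \<omega>)
      show ?case
      proof (cases "\<omega> \<in> A")
        case True
        then show ?thesis using f(2)[of "Y \<omega>"] T(2)[of "Y \<omega>"] e by simp
      next
        case False
        then have "\<bar>Y \<omega> k\<bar> \<le> L" if "k \<le> m" for k using that elim by (auto simp: A_def not_less)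
        then show ?thesis using T(3)[of "Y \<omega>"] elim False by simp
      qed
    qed
  qed (use iT "if" iA in auto)
  also have "\<dots> = e + (2 * B + e) * prob A" using iA by (simp add: prob_space)
  also have "\<dots> \<le> e + (2 * B + e) * e" using tight B e by (intro add_left_mono mult_left_mono) (auto simp: A_def)
  finally show ?thesis .
qed

lemma trig_expectation_tendsto:
  fixes Y :: "nat \<Rightarrow> 'a \<Rightarrow> nat \<Rightarrow> real" and Z :: "'b \<Rightarrow> nat \<Rightarrow> real"
  assumes M: "prob_space M" and N: "prob_space N"
    and Y[measurable]: "\<And>n. Y n \<in> borel_measurable M" and Z[measurable]: "Z \<in> borel_measurable N"
    and cos: "\<And>a b. (\<lambda>n. integral\<^sup>L M (\<lambda>\<omega>. cos ((\<Sum>i\<le>m. a i * Y n \<omega> i) + b))) \<longlonglongrightarrow>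
      integral\<^sup>L N (\<lambda>\<omega>. cos ((\<Sum>i\<le>m. a i * Z \<omega> i) + b))"
    and T: "T \<in> trig m"
  shows "(\<lambda>n. integral\<^sup>L M (\<lambda>\<omega>. T (Y n \<omega>))) \<longlonglongrightarrow> integral\<^sup>L N (\<lambda>\<omega>. T (Z \<omega>))"
proof -
  interpret M: prob_space M by fact
  interpret N: prob_space N by fact
  have int: "integrable M (\<lambda>\<omega>. f (Y n \<omega>)) \<and> integrable N (\<lambda>\<omega>. f (Z \<omega>))" if f: "f \<in> trig m" for f n
  proof -
    have fm[measurable]: "f \<in> borel_measurable borel"
      using trig_continuous[OF f] by (rule borel_measurable_continuous_onI)
    obtain B where B: "\<And>x. \<bar>f x\<bar> \<le> B" using trig_bounded[OF f] by blast
    show ?thesis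
      by (intro conjI M.integrable_const_bound[where B = B] N.integrable_const_bound[where B = B])
        (use B in auto)
  qed
  from T show ?thesis
  proof induction
    case (cos a b)
    then show ?case by (rule assms(5))
  next
    case (scale f c)
    then show ?case using tendsto_mult_left[OF scale.IH, of c] by simp
  next
    case (add f g)
    then show ?case using tendsto_add[OF add.IH] int by simp
  qed
qed

text \<open>Tightness confines all the laws to one box up to small probability. There a
  trigonometric sum replaces the test function, and its expectations converge by linearity.\<close>

theorem cramer_wold:
  fixes Y :: "nat \<Rightarrow> 'a \<Rightarrow> nat \<Rightarrow> real" and Z :: "'b \<Rightarrow> nat \<Rightarrow> real"
  assumes M: "prob_space M" and N: "prob_space N"
    and Y[measurable]: "\<And>n. Y n \<in> borel_measurable M" and Z[measurable]: "Z \<in> borel_measurable N"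
    and supp: "\<And>n. AE \<omega> in M. \<forall>k>m. Y n \<omega> k = 0" "AE \<omega> in N. \<forall>k>m. Z \<omega> k = 0"
    and tight: "\<And>e. e > 0 \<Longrightarrow> \<exists>L. \<forall>n. measure M {\<omega> \<in> space M. \<exists>k\<le>m. \<bar>Y n \<omega> k\<bar> > L} \<le> e"
    and cos: "\<And>a b. (\<lambda>n. integral\<^sup>L M (\<lambda>\<omega>. cos ((\<Sum>i\<le>m. a i * Y n \<omega> i) + b))) \<longlonglongrightarrow>
      integral\<^sup>L N (\<lambda>\<omega>. cos ((\<Sum>i\<le>m. a i * Z \<omega> i) + b))"
  shows "conv_in_distr M Y N Z"
proof -
  interpret M: prob_space M by fact
  interpret N: prob_space N by fact
  have [measurable]: "(\<lambda>\<omega>. Y n \<omega> k) \<in> borel_measurable M" "(\<lambda>\<omega>. Z \<omega> k) \<in> borel_measurable N" for n k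
    by (auto intro: measurable_product_then_coordinatewise)
  have "(\<lambda>n. M.expectation (\<lambda>\<omega>. f (Y n \<omega>))) \<longlonglongrightarrow> N.expectation (\<lambda>\<omega>. f (Z \<omega>))"
    if f: "continuous_on UNIV f" "bounded (range f)" for f :: "(nat \<Rightarrow> real) \<Rightarrow> real"
  proof (rule LIMSEQ_I)
    fix r :: real assume r: "r > 0"
    obtain B where B: "\<And>x. \<bar>f x\<bar> \<le> B" using f(2) unfolding bounded_iff by auto
    then have B0: "B \<ge> 0" by (meson abs_ge_zero order_trans)
    \<comment> \<open>With \<open>e \<le> 1\<close> each approximation error is at most
      \<open>(2 * B + 2) * e\<close>, hence \<open>r / 4\<close>; two of them and one convergence
      error stay below \<open>r\<close>.\<close>
    define e where "e = min 1 (r / (8 * (B + 1)))"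
    have e: "e > 0" "e \<le> 1" using r B0 by (auto simp: e_def)
    have "8 * (B + 1) * e \<le> 8 * (B + 1) * (r / (8 * (B + 1)))"
      using B0 by (intro mult_left_mono) (auto simp: e_def)
    then have er: "8 * (B + 1) * e \<le> r" using B0 by simp
    have "(2 * B + e) * e \<le> (2 * B + 1) * e" using e by (intro mult_right_mono) auto
    then have "e + (2 * B + e) * e \<le> (2 * B + 2) * e" by (simp add: algebra_simps)
    with er have small: "e + (2 * B + e) * e \<le> r / 4" by (simp add: algebra_simps)
    obtain L1 where L1: "\<And>n. M.prob {\<omega> \<in> space M. \<exists>k\<le>m. \<bar>Y n \<omega> k\<bar> > L1} \<le> e"
      using tight[OF e(1)] by blast
    obtain L2 where L2: "N.prob {\<omega> \<in> space N. \<exists>k\<le>m. \<bar>Z \<omega> k\<bar> > L2} \<le> e"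
      using N.tight_coordinates[of Z e m] e(1) by auto
    define L where "L = max 1 (max L1 L2)"
    have L: "L > 0" "L1 \<le> L" "L2 \<le> L" by (auto simp: L_def)
    have "M.prob {\<omega> \<in> space M. \<exists>k\<le>m. \<bar>Y n \<omega> k\<bar> > L} \<le> M.prob {\<omega> \<in> space M. \<exists>k\<le>m. \<bar>Y n \<omega> k\<bar> > L1}" for n
      by (rule M.finite_measure_mono) (use L(2) in force, measurable)
    then have tM: "M.prob {\<omega> \<in> space M. \<exists>k\<le>m. \<bar>Y n \<omega> k\<bar> > L} \<le> e" for n
      using L1[of n] by (rule order_trans)
    have "N.prob {\<omega> \<in> space N. \<exists>k\<le>m. \<bar>Z \<omega> k\<bar> > L} \<le> N.prob {\<omega> \<in> space N. \<exists>k\<le>m. \<bar>Z \<omega> k\<bar> > L2}"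
      by (rule N.finite_measure_mono) (use L(3) in force, measurable)
    then have tN: "N.prob {\<omega> \<in> space N. \<exists>k\<le>m. \<bar>Z \<omega> k\<bar> > L} \<le> e"
      using L2 by (rule order_trans)
    obtain T where T: "T \<in> trig m" "\<And>x. \<bar>T x\<bar> \<le> B + e"
      "\<And>x. (\<And>k. k \<le> m \<Longrightarrow> \<bar>x k\<bar> \<le> L) \<Longrightarrow> (\<And>k. k > m \<Longrightarrow> x k = 0) \<Longrightarrow> \<bar>f x - T x\<bar> \<le> e"
      using trig_approx[OF f(1) B L(1) e(1)] by blast
    have aM: "\<bar>M.expectation (\<lambda>\<omega>. f (Y n \<omega>)) - M.expectation (\<lambda>\<omega>. T (Y n \<omega>))\<bar> \<le> r / 4" for n
      using M.trig_approx_expectation[OF Y supp(1) tM f(1) B T e(1)] small by (rule order_trans)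
    have aN: "\<bar>N.expectation (\<lambda>\<omega>. f (Z \<omega>)) - N.expectation (\<lambda>\<omega>. T (Z \<omega>))\<bar> \<le> r / 4"
      using N.trig_approx_expectation[OF Z supp(2) tN f(1) B T e(1)] small by (rule order_trans)
    have "(\<lambda>n. M.expectation (\<lambda>\<omega>. T (Y n \<omega>))) \<longlonglongrightarrow> N.expectation (\<lambda>\<omega>. T (Z \<omega>))"
      by (rule trig_expectation_tendsto[OF M N Y Z cos T(1)])
    then obtain n0 where n0: "\<And>n. n \<ge> n0 \<Longrightarrow>
        norm (M.expectation (\<lambda>\<omega>. T (Y n \<omega>)) - N.expectation (\<lambda>\<omega>. T (Z \<omega>))) < r / 4"
      using LIMSEQ_D[of _ _ "r / 4"] r by (metis divide_pos_pos zero_less_numeral)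
    have "norm (M.expectation (\<lambda>\<omega>. f (Y n \<omega>)) - N.expectation (\<lambda>\<omega>. f (Z \<omega>))) < r" if "n \<ge> n0" for n
      using aM[of n] aN that[THEN n0] r unfolding real_norm_def by linarith
    then show "\<exists>no. \<forall>n\<ge>no. norm (M.expectation (\<lambda>\<omega>. f (Y n \<omega>)) - N.expectation (\<lambda>\<omega>. f (Z \<omega>))) < r"
      by blast
  qed
  then show ?thesis by (simp add: conv_in_distr_def)
qed

section \<open>Empirical pmf and Brownian bridge\<close>

locale iid_sample = prob_space M for M :: "'a measure" +
  fixes X :: "nat \<Rightarrow> 'a \<Rightarrow> nat" and q :: "nat pmf"
  assumes X_meas[measurable]: "\<And>i. X i \<in> measurable M (count_space UNIV)"
    and X_indep: "indep_vars (\<lambda>_. count_space UNIV) X UNIV"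
    and X_distr: "\<And>i. distr M (count_space UNIV) (X i) = measure_pmf q"
begin

lemma X_fun_meas [measurable]: "(\<lambda>\<omega>. g (X i \<omega>)) \<in> borel_measurable M" for g :: "nat \<Rightarrow> real"
  by (rule measurable_compose[OF X_meas]) simp

lemma expectation_X: "expectation (\<lambda>\<omega>. g (X i \<omega>)) = measure_pmf.expectation q g" for g :: "nat \<Rightarrow> real"
  using integral_distr[of "X i" M "count_space UNIV" g] by (simp add: X_distr)

lemma AE_X: "(AE \<omega> in M. P (X i \<omega>)) \<longleftrightarrow> (\<forall>x\<in>set_pmf q. P x)"
  using AE_distr_iff[of "X i" M "count_space UNIV" P] unfolding X_distr by (simp add: AE_measure_pmf_iff)

lemma distr_X_fun: "distr M borel (\<lambda>\<omega>. g (X i \<omega>)) = distr (measure_pmf q) borel g" for g :: "nat \<Rightarrow> real"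
  using distr_distr[of g "count_space UNIV" borel "X i" M] by (simp add: X_distr o_def)

lemma indep_X_fun: "indep_vars (\<lambda>_. borel) (\<lambda>i \<omega>. g (X i \<omega>)) UNIV" for g :: "nat \<Rightarrow> real"
  by (rule indep_vars_compose2[OF X_indep]) simp

lemma emp_pmf_eq: "emp_pmf X n \<omega> j = (\<Sum>i<n. of_bool (X i \<omega> = j)) / real n"
proof -
  have "(\<Sum>i<n. of_bool (X i \<omega> = j) :: real) = real (card {i \<in> {..<n}. X i \<omega> = j})"
    using sum.inter_filter[of "{..<n}" "\<lambda>_. 1::real" "\<lambda>i. X i \<omega> = j"] by (simp add: of_bool_def)
  then show ?thesis by (simp add: emp_pmf_def)
qed

lemma emp_pmf_meas [measurable]: "(\<lambda>\<omega>. emp_pmf X n \<omega> j) \<in> borel_measurable M"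
  unfolding emp_pmf_eq by (intro borel_measurable_divide borel_measurable_sum X_fun_meas borel_measurable_const)

lemma emp_pmf_hoeffding:
  assumes n: "n \<ge> 1" and e: "e \<ge> 0"
  shows "prob {\<omega> \<in> space M. \<bar>emp_pmf X n \<omega> j - pmf q j\<bar> \<ge> e} \<le> 2 * exp (- 2 * real n * e\<^sup>2)"
proof -
  let ?g = "\<lambda>x. of_bool (x = j) :: real"
  interpret Hoeffding_ineq_iid M "{..<n}" "\<lambda>i \<omega>. ?g (X i \<omega>)" "\<lambda>\<omega>. ?g (X 0 \<omega>)" 0 1 "pmf q j"
  proof unfold_locales
    show "indep_vars (\<lambda>_. borel) (\<lambda>i \<omega>. ?g (X i \<omega>)) {..<n}"
      by (rule indep_vars_subset[OF indep_X_fun]) simp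
    show "distr M borel (\<lambda>\<omega>. ?g (X i \<omega>)) = distr M borel (\<lambda>\<omega>. ?g (X 0 \<omega>))" for i
      using distr_X_fun[where i = i and g = ?g] distr_X_fun[where i = 0 and g = ?g] by simp
    have "measure_pmf.expectation q ?g = (\<Sum>a\<in>{j}. ?g a * pmf q a)"
      by (rule integral_measure_pmf_real) auto
    then have "pmf q j = expectation (\<lambda>\<omega>. ?g (X 0 \<omega>))"
      using expectation_X[where g = ?g and i = 0] by simp
    then show "pmf q j \<equiv> expectation (\<lambda>\<omega>. ?g (X 0 \<omega>))" by (rule eq_reflection)
  qed auto
  show ?thesis using Hoeffding_ineq_abs_ge'[OF e] n by (simp add: emp_pmf_eq lessThan_empty_iff)
qed

text \<open>Hoeffding's bound is geometric in \<open>n\<close>, hence summable. Borel-Cantelli is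
  applied for each cell and each tolerance \<open>1 / Suc r\<close>, countably many, so that the
  null sets can be united.\<close>

lemma emp_pmf_slln: "AE \<omega> in M. \<forall>j. (\<lambda>n. emp_pmf X n \<omega> j) \<longlonglongrightarrow> pmf q j"
proof -
  have "AE \<omega> in M. eventually (\<lambda>n. \<bar>emp_pmf X n \<omega> j - pmf q j\<bar> < 1 / real (Suc r)) sequentially" for j r
  proof -
    let ?e = "1 / real (Suc r)"
    define A where "A n = {\<omega> \<in> space M. \<bar>emp_pmf X n \<omega> j - pmf q j\<bar> \<ge> ?e}" for n
    have A[measurable]: "A n \<in> events" for n unfolding A_def by measurable
    have "AE \<omega> in M. eventually (\<lambda>n. \<omega> \<in> space M - A n) sequentially"
    proof (rule borel_cantelli_AE1)
      show "summable (\<lambda>n. prob (A n))"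
      proof (rule summable_comparison_test_ev)
        show "summable (\<lambda>n. 2 * exp (- 2 * ?e\<^sup>2) ^ n)"
          by (intro summable_mult summable_geometric) auto
        show "eventually (\<lambda>n. norm (prob (A n)) \<le> 2 * exp (- 2 * ?e\<^sup>2) ^ n) sequentially"
          using eventually_ge_at_top[of 1]
        proof eventually_elim
          case (elim n)
          have "exp (- 2 * ?e\<^sup>2) ^ n = exp (- 2 * real n * ?e\<^sup>2)"
            by (simp add: exp_of_nat_mult[symmetric] mult_ac)
          then show ?case using emp_pmf_hoeffding[OF elim, of ?e j] by (simp add: A_def)
        qed
      qed
    qed (auto simp: less_top[symmetric])
    then show ?thesis
    proof eventually_elim
      case (elim \<omega>)
      then show ?case by eventually_elim (auto simp: A_def)
    qed
  qed
  then have "AE \<omega> in M. \<forall>j r. eventually (\<lambda>n. \<bar>emp_pmf X n \<omega> j - pmf q j\<bar> < 1 / real (Suc r)) sequentially"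
    by (simp add: AE_all_countable)
  then show ?thesis
  proof eventually_elim
    case (elim \<omega>)
    show ?case
    proof (intro allI tendstoI)
      fix j and e :: real assume "e > 0"
      then obtain r where "1 / real (Suc r) < e" using nat_approx_posE by blast
      with elim[rule_format, of j r]
      show "eventually (\<lambda>n. dist (emp_pmf X n \<omega> j) (pmf q j) < e) sequentially"
        by (auto elim!: eventually_mono simp: dist_real_def)
    qed
  qed
qed

lemma emp_pmf_tight:
  assumes e: "e > 0"
  shows "\<exists>L. \<forall>n. prob {\<omega> \<in> space M. \<exists>k\<le>m. \<bar>sqrt (real n) * (emp_pmf X n \<omega> k - pmf q k)\<bar> > L} \<le> e"
proof -
  \<comment> \<open>Hoeffding at level \<open>L / sqrt n\<close> gives
    \<open>2 * exp (- 2 * L^2)\<close> for every positive \<open>n\<close>. Since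
    \<open>L \<ge> 1\<close>, the exponent dominates \<open>L\<close> and thus the logarithm, which
    absorbs the union bound over \<open>m + 1\<close> cells.\<close>
  define L where "L = max 1 (ln (2 * real (Suc m) / e))"
  have L1: "L \<ge> 1" by (simp add: L_def)
  then have "1 * L \<le> 2 * L * L" by (intro mult_right_mono) auto
  then have "exp (- (2 * L\<^sup>2)) \<le> exp (- L)" by (simp add: power2_eq_square)
  also have "\<dots> \<le> exp (- ln (2 * real (Suc m) / e))" by (simp add: L_def)
  also have "\<dots> = e / (2 * real (Suc m))" using e by (simp add: exp_minus)
  finally have L: "2 * exp (- (2 * L\<^sup>2)) * real (Suc m) \<le> e" by (simp add: field_simps)
  have "prob {\<omega> \<in> space M. \<exists>k\<le>m. \<bar>sqrt (real n) * (emp_pmf X n \<omega> k - pmf q k)\<bar> > L} \<le> e" for n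
  proof (cases "n = 0")
    case True
    then show ?thesis using e L1 by simp
  next
    case False
    define B where "B k = {\<omega> \<in> space M. \<bar>emp_pmf X n \<omega> k - pmf q k\<bar> \<ge> L / sqrt (real n)}" for k
    have B: "B k \<in> events" for k unfolding B_def by measurable
    have pB: "prob (B k) \<le> 2 * exp (- (2 * L\<^sup>2))" for k
      using emp_pmf_hoeffding[of n "L / sqrt (real n)" k] False L1 by (simp add: B_def power_divide)
    have "prob {\<omega> \<in> space M. \<exists>k\<le>m. \<bar>sqrt (real n) * (emp_pmf X n \<omega> k - pmf q k)\<bar> > L} \<le> prob (\<Union>k\<le>m. B k)"
    proof (rule finite_measure_mono)
      show "{\<omega> \<in> space M. \<exists>k\<le>m. \<bar>sqrt (real n) * (emp_pmf X n \<omega> k - pmf q k)\<bar> > L} \<subseteq> (\<Union>k\<le>m. B k)"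
      proof safe
        fix \<omega> k assume k: "\<omega> \<in> space M" "k \<le> m" "\<bar>sqrt (real n) * (emp_pmf X n \<omega> k - pmf q k)\<bar> > L"
        then have "L < sqrt (real n) * \<bar>emp_pmf X n \<omega> k - pmf q k\<bar>" by (simp add: abs_mult)
        then have "L / sqrt (real n) \<le> \<bar>emp_pmf X n \<omega> k - pmf q k\<bar>"
          using False by (simp add: divide_le_eq mult.commute)
        then show "\<omega> \<in> (\<Union>k\<le>m. B k)" using k by (auto simp: B_def)
      qed
    qed (intro sets.finite_UN finite_atMost B)
    also have "\<dots> \<le> (\<Sum>k\<le>m. prob (B k))"
      by (rule finite_measure_subadditive_finite) (use B in blast)+
    also have "\<dots> \<le> (\<Sum>k\<le>m. 2 * exp (- (2 * L\<^sup>2)))" by (intro sum_mono pB)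
    also have "\<dots> \<le> e" using L by (simp add: mult.commute)
    finally show ?thesis .
  qed
  then show ?thesis by blast
qed

text \<open>Here \<open>v\<close> is the variance of \<open>a\<close> at one observation, with
  \<open>a\<close> cut off beyond \<open>m\<close>. The limit is an integral against the standard
  normal law so that it also covers \<open>v = 0\<close> and matches
  \<open>centered_normal_cos\<close>.\<close>

lemma emp_pmf_linear_clt:
  fixes a :: "nat \<Rightarrow> real" and m :: nat
  defines "v \<equiv> (\<Sum>k\<le>m. (a k)\<^sup>2 * pmf q k) - (\<Sum>k\<le>m. a k * pmf q k)\<^sup>2"
  shows "(\<lambda>n. expectation (\<lambda>\<omega>. cos ((\<Sum>k\<le>m. a k * (sqrt (real n) * (emp_pmf X n \<omega> k - pmf q k))) + b)))
    \<longlonglongrightarrow> integral\<^sup>L std_normal_distribution (\<lambda>x. cos (sqrt v * x + b))"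
proof -
  interpret D: real_distribution std_normal_distribution by (rule real_dist_normal_dist)
  define \<mu> where "\<mu> = (\<Sum>k\<le>m. a k * pmf q k)"
  \<comment> \<open>The centred contribution of one observation; the linear combination of cell
    deviations becomes a normalised sum of i.i.d. terms.\<close>
  define h where "h x = (if x \<le> m then a x else 0) - \<mu>" for x
  have Eg: "measure_pmf.expectation q (\<lambda>x. if x \<le> m then f x else 0) = (\<Sum>k\<le>m. f k * pmf q k)"
    for f :: "nat \<Rightarrow> real"
  proof -
    have "measure_pmf.expectation q (\<lambda>x. if x \<le> m then f x else 0) =
      (\<Sum>k\<in>{..m}. (if k \<le> m then f k else 0) * pmf q k)"
      by (rule integral_measure_pmf_real) (auto split: if_splits)
    then show ?thesis by simp
  qed
  have int: "integrable (measure_pmf q) (\<lambda>x. if x \<le> m then f x else 0)" for f :: "nat \<Rightarrow> real"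
  proof (rule measure_pmf.integrable_const_bound[where B = "\<Sum>k\<le>m. \<bar>f k\<bar>"])
    show "AE x in measure_pmf q. norm (if x \<le> m then f x else 0) \<le> (\<Sum>k\<le>m. \<bar>f k\<bar>)"
      by (auto intro!: AE_I2 member_le_sum[where f = "\<lambda>k. \<bar>f k\<bar>"] sum_nonneg)
  qed simp
  have Eh: "measure_pmf.expectation q h = 0"
    unfolding h_def using Eg[of a] int[of a] by (simp add: \<mu>_def)
  have h2: "(h x)\<^sup>2 = (if x \<le> m then (a x)\<^sup>2 else 0) - 2 * \<mu> * (if x \<le> m then a x else 0) + \<mu>\<^sup>2" for x
    by (simp add: h_def power2_diff)
  have Eh2: "measure_pmf.expectation q (\<lambda>x. (h x)\<^sup>2) = v"
    unfolding h2 using Eg[of a] int[of a] Eg[of "\<lambda>x. (a x)\<^sup>2"] int[of "\<lambda>x. (a x)\<^sup>2"]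
    by (simp add: v_def \<mu>_def[symmetric] power2_eq_square)
  have ih2: "integrable (measure_pmf q) (\<lambda>x. (h x)\<^sup>2)"
    unfolding h2 using int[of a] int[of "\<lambda>x. (a x)\<^sup>2"]
    by (intro Bochner_Integration.integrable_add Bochner_Integration.integrable_diff integrable_mult_right) auto
  have sum_h: "(\<Sum>k\<le>m. a k * (sqrt (real n) * (emp_pmf X n \<omega> k - pmf q k))) = (\<Sum>i<n. h (X i \<omega>)) / sqrt (real n)"
    if n: "n > 0" for n \<omega>
  proof -
    have "(\<Sum>k\<le>m. a k * emp_pmf X n \<omega> k) = (\<Sum>k\<le>m. \<Sum>i<n. a k * of_bool (X i \<omega> = k)) / real n"
      unfolding emp_pmf_eq by (simp only: sum_distrib_left times_divide_eq_right sum_divide_distrib)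
    also have "(\<Sum>k\<le>m. \<Sum>i<n. a k * of_bool (X i \<omega> = k)) = (\<Sum>i<n. \<Sum>k\<le>m. a k * of_bool (X i \<omega> = k))"
      by (rule sum.swap)
    also have "\<dots> = (\<Sum>i<n. h (X i \<omega>) + \<mu>)"
    proof (rule sum.cong)
      fix i
      have "(\<Sum>k\<le>m. a k * of_bool (X i \<omega> = k)) = (\<Sum>k\<le>m. if X i \<omega> = k then a k else 0)"
        by (intro sum.cong) auto
      then show "(\<Sum>k\<le>m. a k * of_bool (X i \<omega> = k)) = h (X i \<omega>) + \<mu>" by (simp add: h_def)
    qed simp
    finally have "(\<Sum>k\<le>m. a k * (emp_pmf X n \<omega> k - pmf q k)) = (\<Sum>i<n. h (X i \<omega>)) / real n"
      using n by (simp add: right_diff_distrib sum_subtractf \<mu>_def sum.distrib add_divide_distrib)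
    then have "sqrt (real n) * (\<Sum>k\<le>m. a k * (emp_pmf X n \<omega> k - pmf q k)) =
        sqrt (real n) * ((\<Sum>i<n. h (X i \<omega>)) / real n)" by simp
    also have "\<dots> = (\<Sum>i<n. h (X i \<omega>)) / sqrt (real n)"
      using n by (simp add: field_simps real_sqrt_mult[symmetric])
    finally show ?thesis by (simp add: sum_distrib_left mult_ac)
  qed
  have v0: "v \<ge> 0" using Eh2 by (metis (no_types, lifting) integral_nonneg_AE AE_I2 zero_le_power2)
  show ?thesis
  \<comment> \<open>The central limit theorem asks for positive variance. Zero variance does occur,
    for instance when \<open>a\<close> is constant on a support inside \<open>{0..m}\<close>, as the
    deviations then sum to 0; in that case \<open>h\<close> vanishes on the support.\<close>
  proof (cases "v = 0")
    case True
    then have "AE x in measure_pmf q. (h x)\<^sup>2 = 0"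
      using Eh2 integral_nonneg_eq_0_iff_AE[OF ih2] by simp
    then have "\<forall>x\<in>set_pmf q. h x = 0" by (simp add: AE_measure_pmf_iff)
    then have "AE \<omega> in M. \<forall>i. h (X i \<omega>) = 0"
      unfolding AE_all_countable using AE_X[where P = "\<lambda>x. h x = 0"] by simp
    then have "AE \<omega> in M. cos ((\<Sum>k\<le>m. a k * (sqrt (real n) * (emp_pmf X n \<omega> k - pmf q k))) + b) = cos b"
      for n
    proof eventually_elim
      case (elim \<omega>)
      then show ?case by (cases "n = 0") (simp_all add: sum_h)
    qed
    then have "expectation (\<lambda>\<omega>. cos ((\<Sum>k\<le>m. a k * (sqrt (real n) * (emp_pmf X n \<omega> k - pmf q k))) + b)) =
        expectation (\<lambda>\<omega>. cos b)" for n
      by (intro integral_cong_AE) measurable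
    then show ?thesis using True prob_space D.prob_space by simp
  next
    case False
    define \<sigma> where "\<sigma> = sqrt v"
    have \<sigma>: "\<sigma> > 0" "\<sigma>\<^sup>2 = v" using False v0 by (auto simp: \<sigma>_def)
    have wc: "weak_conv_m (\<lambda>n. distr M borel (\<lambda>\<omega>. (\<Sum>i<n. h (X i \<omega>)) / sqrt (n * \<sigma>\<^sup>2))) std_normal_distribution"
    proof (rule central_limit_theorem_zero_mean[OF indep_X_fun])
      show "expectation (\<lambda>\<omega>. h (X n \<omega>)) = 0" for n by (simp only: expectation_X Eh)
      then show "variance (\<lambda>\<omega>. h (X n \<omega>)) = \<sigma>\<^sup>2" for n
        using expectation_X[of "\<lambda>x. (h x)\<^sup>2" n] by (simp add: Eh2 \<sigma>(2))
      show "distr M borel (\<lambda>\<omega>. h (X n \<omega>)) = distr (measure_pmf q) borel h" for n by (rule distr_X_fun)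
      show "integrable M (\<lambda>\<omega>. (h (X n \<omega>))\<^sup>2)" for n
        using integrable_distr_eq[of "X n" M "count_space UNIV" "\<lambda>x. (h x)\<^sup>2"] ih2 by (simp add: X_distr)
    qed (rule \<sigma>(1))
    have "(\<lambda>n. integral\<^sup>L (distr M borel (\<lambda>\<omega>. (\<Sum>i<n. h (X i \<omega>)) / sqrt (n * \<sigma>\<^sup>2))) (\<lambda>x. cos (\<sigma> * x + b)))
        \<longlonglongrightarrow> integral\<^sup>L std_normal_distribution (\<lambda>x. cos (\<sigma> * x + b))"
    proof (rule weak_conv_imp_integral_bdd_continuous_conv[OF _ _ wc])
      show "real_distribution (distr M borel (\<lambda>\<omega>. (\<Sum>i<n. h (X i \<omega>)) / sqrt (n * \<sigma>\<^sup>2)))" for n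
        by (intro real_distribution_distr) measurable
      show "isCont (\<lambda>x. cos (\<sigma> * x + b)) x" for x by (intro continuous_intros)
      show "norm (cos (\<sigma> * x + b)) \<le> 1" for x by simp
    qed (rule real_dist_normal_dist)
    moreover have "eventually (\<lambda>n. integral\<^sup>L (distr M borel (\<lambda>\<omega>. (\<Sum>i<n. h (X i \<omega>)) / sqrt (n * \<sigma>\<^sup>2))) (\<lambda>x. cos (\<sigma> * x + b)) =
        expectation (\<lambda>\<omega>. cos ((\<Sum>k\<le>m. a k * (sqrt (real n) * (emp_pmf X n \<omega> k - pmf q k))) + b))) sequentially"
      using eventually_gt_at_top[of 0]
    proof eventually_elim
      case (elim n)
      have "integral\<^sup>L (distr M borel (\<lambda>\<omega>. (\<Sum>i<n. h (X i \<omega>)) / sqrt (n * \<sigma>\<^sup>2))) (\<lambda>x. cos (\<sigma> * x + b)) =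
          expectation (\<lambda>\<omega>. cos (\<sigma> * ((\<Sum>i<n. h (X i \<omega>)) / sqrt (n * \<sigma>\<^sup>2)) + b))"
        by (intro integral_distr) measurable
      also have "(\<lambda>\<omega>. cos (\<sigma> * ((\<Sum>i<n. h (X i \<omega>)) / sqrt (n * \<sigma>\<^sup>2)) + b)) =
          (\<lambda>\<omega>. cos ((\<Sum>i<n. h (X i \<omega>)) / sqrt (real n) + b))"
        using \<sigma>(1) by (simp add: real_sqrt_mult)
      finally show ?case using elim by (simp add: sum_h)
    qed
    ultimately show ?thesis unfolding \<sigma>_def[symmetric] by (rule Lim_transform_eventually)
  qed
qed

text \<open>A function of finitely many discrete observations factors through the countable set of
  lists, on which every function is measurable. This handles estimators given only by a definite
  description.\<close>

lemma sample_function_meas: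
  assumes f: "\<And>\<omega> \<omega>'. (\<And>i. i < n \<Longrightarrow> X i \<omega> = X i \<omega>') \<Longrightarrow> f \<omega> = f \<omega>'"
  shows "f \<in> measurable M (borel :: 'c::topological_space measure)"
proof -
  define l where "l \<omega> = map (\<lambda>i. X i \<omega>) [0..<n]" for \<omega>
  define g where "g xs = f (SOME \<omega>. l \<omega> = xs)" for xs
  have l: "l \<in> measurable M (count_space UNIV)"
  proof -
    have eq: "l \<omega> = xs \<longleftrightarrow> length xs = n \<and> (\<forall>i\<in>{..<n}. X i \<omega> = xs ! i)" for \<omega> xs
      unfolding l_def list_eq_iff_nth_eq by auto
    have "l -` {xs} \<inter> space M \<in> events" for xs
    proof (cases "length xs = n")
      case True
      have "l -` {xs} \<inter> space M = {\<omega> \<in> space M. \<forall>i\<in>{..<n}. X i \<omega> = xs ! i}"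
        using True eq[of _ xs] by blast
      also have "\<dots> \<in> events" by measurable
      finally show ?thesis .
    next
      case False
      then have "l -` {xs} \<inter> space M = {}" using eq[of _ xs] by blast
      then show ?thesis by simp
    qed
    then show ?thesis by (subst measurable_count_space_eq2_countable) auto
  qed
  have "f \<omega> = g (l \<omega>)" for \<omega>
  proof -
    have "l (SOME \<omega>'. l \<omega>' = l \<omega>) = l \<omega>" by (rule someI) simp
    then have "X i (SOME \<omega>'. l \<omega>' = l \<omega>) = X i \<omega>" if "i < n" for i
      using that by (auto simp: l_def)
    from f[OF this] show ?thesis by (simp add: g_def)
  qed
  then have "f = (\<lambda>\<omega>. g (l \<omega>))" by auto
  then show ?thesis using measurable_compose[OF l, of g borel] by simp
qed

end

lemma centered_normal_cos:
  assumes N: "prob_space N" and L: "centered_normal N L v"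
  shows "integral\<^sup>L N (\<lambda>\<omega>. cos (L \<omega> + b)) = integral\<^sup>L std_normal_distribution (\<lambda>x. cos (sqrt v * x + b))"
proof -
  interpret N: prob_space N by fact
  interpret D: real_distribution std_normal_distribution by (rule real_dist_normal_dist)
  consider "v = 0" "L \<in> borel_measurable N" "AE \<omega> in N. L \<omega> = 0"
    | "v > 0" "distributed N lborel L (\<lambda>x. ennreal (normal_density 0 (sqrt v) x))"
    using L by (auto simp: centered_normal_def)
  then show ?thesis
  proof cases
    case 1
    have "integral\<^sup>L N (\<lambda>\<omega>. cos (L \<omega> + b)) = integral\<^sup>L N (\<lambda>\<omega>. cos b)"
      by (rule integral_cong_AE) (use 1 in auto)
    then show ?thesis using 1 N.prob_space D.prob_space by simp
  next
    case 2
    then have "distributed N lborel (\<lambda>\<omega>. (L \<omega> - 0) / sqrt v) std_normal_density"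
      by (subst N.normal_standard_normal_convert[symmetric]) auto
    from distributed_integral[OF this, of "\<lambda>x. cos (sqrt v * x + b)"]
    have "(\<integral>x. std_normal_density x * cos (sqrt v * x + b) \<partial>lborel) = integral\<^sup>L N (\<lambda>\<omega>. cos (L \<omega> + b))"
      using 2(1) by simp
    moreover have "integral\<^sup>L std_normal_distribution (\<lambda>x. cos (sqrt v * x + b)) =
        (\<integral>x. std_normal_density x * cos (sqrt v * x + b) \<partial>lborel)"
      by (rule integral_real_density) auto
    ultimately show ?thesis by simp
  qed
qed

text \<open>Abel summation; the conditionals encode the boundary convention that \<open>a\<close> is
  0 at the index before 0 and beyond \<open>n\<close>.\<close>

lemma sum_by_parts:
  fixes a u :: "nat \<Rightarrow> real"
  shows "(\<Sum>i\<le>Suc n. ((if i = 0 then 0 else a (i - 1)) - (if i \<le> n then a i else 0)) * u i) =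
    (\<Sum>j\<le>n. a j * (u (Suc j) - u j))"
proof -
  have "(\<Sum>i\<le>Suc n. (if i = 0 then 0 else a (i - 1)) * u i) = (\<Sum>j\<le>n. a j * u (Suc j))"
    by (subst sum.atMost_Suc_shift) simp
  moreover have "(\<Sum>i\<le>Suc n. (if i \<le> n then a i else 0) * u i) = (\<Sum>j\<le>n. a j * u j)"
    by simp
  ultimately show ?thesis by (simp only: left_diff_distrib right_diff_distrib sum_subtractf)
qed

text \<open>Gaussianity of the bridge is stated for combinations of values over a finite set of
  times, so increments are first summed by parts. Positive \<open>r\<close> makes the times
  distinct, hence a sum over indices is a sum over that set.\<close>

lemma bridge_increments_centered_normal:
  fixes t r a :: "nat \<Rightarrow> real"
  assumes U: "brownian_bridge N U" and t: "\<And>i. t (Suc i) = t i + r i" "\<And>i. t i \<in> {0..1}"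
    and r: "\<And>i. i \<le> n \<Longrightarrow> r i > 0"
  shows "centered_normal N (\<lambda>\<omega>. \<Sum>j\<le>n. a j * (U (t (Suc j)) \<omega> - U (t j) \<omega>))
    ((\<Sum>j\<le>n. (a j)\<^sup>2 * r j) - (\<Sum>j\<le>n. a j * r j)\<^sup>2)"
proof -
  define c where "c i = (if i = 0 then 0 else a (i - 1)) - (if i \<le> n then a i else 0)" for i
  have less: "t i < t j" if "i < j" "j \<le> Suc n" for i j
    using that
  proof (induction j)
    case (Suc j)
    then show ?case using r[of j] t(1)[of j] by (cases "i = j") auto
  qed simp
  then have inj: "inj_on t {..Suc n}"
    by (intro linorder_inj_onI) (auto simp: order.strict_iff_order)
  define T where "T = t ` {..Suc n}"
  define d where "d x = c (inv_into {..Suc n} t x)" for x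
  \<comment> \<open>Stated for arbitrary \<open>f\<close>, to serve the paths of \<open>U\<close> as
    well as both arguments of the covariance kernel.\<close>
  have reindex: "(\<Sum>x\<in>T. d x * f x) = (\<Sum>j\<le>n. a j * (f (t (Suc j)) - f (t j)))" for f :: "real \<Rightarrow> real"
  proof -
    have "(\<Sum>x\<in>T. d x * f x) = (\<Sum>i\<le>Suc n. c i * f (t i))"
      unfolding T_def by (subst sum.reindex[OF inj]) (auto simp: d_def inj intro!: sum.cong)
    then show ?thesis unfolding c_def using sum_by_parts[of a n "\<lambda>i. f (t i)"] by simp
  qed
  \<comment> \<open>The covariance of two increments is that of the cell indicators of one
    multinomial observation, which is why the bridge is the right limit.\<close>
  have inc: "(min (t (Suc k)) (t (Suc j)) - t (Suc k) * t (Suc j) - (min (t (Suc k)) (t j) - t (Suc k) * t j)) -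
      (min (t k) (t (Suc j)) - t k * t (Suc j) - (min (t k) (t j) - t k * t j)) = of_bool (k = j) * r k - r k * r j"
    if "k \<le> n" "j \<le> n" for k j
  proof -
    have le: "t i \<le> t j" if "i \<le> j" "j \<le> Suc n" for i j using less[of i j] that by (cases "i = j") auto
    consider "k < j" | "j < k" | "k = j" by linarith
    then show ?thesis
    proof cases
      case 1
      then have "t (Suc k) \<le> t j" "t k \<le> t (Suc k)" "t j \<le> t (Suc j)" using that le by auto
      then show ?thesis using 1 by (simp add: t(1) algebra_simps)
    next
      case 2
      then have "t (Suc j) \<le> t k" "t k \<le> t (Suc k)" "t j \<le> t (Suc j)" using that le by auto
      then show ?thesis using 2 by (simp add: t(1) algebra_simps)
    next
      case 3
      then show ?thesis using r[of k] that by (simp add: t(1) algebra_simps)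
    qed
  qed
  have "(\<Sum>x\<in>T. \<Sum>y\<in>T. d x * d y * (min x y - x * y)) = (\<Sum>x\<in>T. d x * (\<Sum>y\<in>T. d y * (min x y - x * y)))"
    by (simp add: sum_distrib_left mult.assoc)
  also have "\<dots> = (\<Sum>k\<le>n. a k * (\<Sum>j\<le>n. a j * (of_bool (k = j) * r k - r k * r j)))"
    unfolding reindex
  proof (intro sum.cong refl arg_cong2[where f = "(*)"])
    fix k assume k: "k \<in> {..n}"
    show "(\<Sum>j\<le>n. a j * (min (t (Suc k)) (t (Suc j)) - t (Suc k) * t (Suc j) - (min (t (Suc k)) (t j) - t (Suc k) * t j))) -
      (\<Sum>j\<le>n. a j * (min (t k) (t (Suc j)) - t k * t (Suc j) - (min (t k) (t j) - t k * t j))) =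
      (\<Sum>j\<le>n. a j * (of_bool (k = j) * r k - r k * r j))"
      unfolding sum_subtractf[symmetric] right_diff_distrib[symmetric]
      by (intro sum.cong refl arg_cong2[where f = "(*)"] inc) (use k in auto)
  qed
  also have "\<dots> = (\<Sum>k\<le>n. (a k)\<^sup>2 * r k) - (\<Sum>k\<le>n. a k * r k)\<^sup>2"
  proof -
    have "a k * (\<Sum>j\<le>n. a j * (of_bool (k = j) * r k - r k * r j)) =
        (a k)\<^sup>2 * r k - a k * r k * (\<Sum>j\<le>n. a j * r j)" if "k \<le> n" for k
    proof -
      have "(\<Sum>j\<le>n. a j * (of_bool (k = j) * r k)) = (\<Sum>j\<le>n. if k = j then a j * r k else 0)"
        by (intro sum.cong) auto
      then have "(\<Sum>j\<le>n. a j * (of_bool (k = j) * r k)) = a k * r k" using that by simp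
      then have eq: "(\<Sum>j\<le>n. a j * (of_bool (k = j) * r k - r k * r j)) = a k * r k - r k * (\<Sum>j\<le>n. a j * r j)"
        by (simp add: right_diff_distrib sum_subtractf sum_distrib_left mult_ac)
      show ?thesis unfolding eq by (simp add: power2_eq_square algebra_simps)
    qed
    then have "(\<Sum>k\<le>n. a k * (\<Sum>j\<le>n. a j * (of_bool (k = j) * r k - r k * r j))) =
        (\<Sum>k\<le>n. (a k)\<^sup>2 * r k - a k * r k * (\<Sum>j\<le>n. a j * r j))" by (intro sum.cong) auto
    then show ?thesis by (simp add: sum_subtractf sum_distrib_right[symmetric] power2_eq_square)
  qed
  finally have var: "(\<Sum>x\<in>T. \<Sum>y\<in>T. d x * d y * (min x y - x * y)) =
    (\<Sum>k\<le>n. (a k)\<^sup>2 * r k) - (\<Sum>k\<le>n. a k * r k)\<^sup>2" .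
  have "finite T" "T \<subseteq> {0..1}" using t(2) by (auto simp: T_def)
  then have "centered_normal N (\<lambda>\<omega>. \<Sum>x\<in>T. d x * U x \<omega>) (\<Sum>x\<in>T. \<Sum>y\<in>T. d x * d y * (min x y - x * y))"
    using U unfolding brownian_bridge_def by blast
  then show ?thesis unfolding var reindex .
qed

section \<open>The limit theorem\<close>

lemma continuous_on_sq_argmin:
  assumes P: "\<And>g. P g \<longleftrightarrow> (\<forall>k\<in>C. 0 \<le> sdiff g k)" and C: "C \<subseteq> {a<..<b}"
  shows "continuous_on UNIV (\<lambda>w. sq_argmin P a b w k)"
proof -
  have proj: "is_proj C a b w (sq_argmin P a b w)" for w
    using is_proj_exists[OF C, of w] sq_argmin_eq[OF P] by metis
  have "((\<lambda>w. sq_argmin P a b w k) \<longlongrightarrow> sq_argmin P a b v k) (at v)" for v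
  proof (rule LIM_zero_cancel, rule Lim_null_comparison)
    show "eventually (\<lambda>w. norm (sq_argmin P a b w k - sq_argmin P a b v k) \<le> L2_set (\<lambda>j. w j - v j) {a..b}) (at v)"
      using is_proj_lipschitz[OF proj proj] by (intro always_eventually) simp
    have "continuous_on UNIV (\<lambda>w. L2_set (\<lambda>j. w j - v j) {a..b})"
      unfolding L2_set_def by (intro continuous_intros continuous_on_product_coordinates)
    then have "((\<lambda>w. L2_set (\<lambda>j. w j - v j) {a..b}) \<longlongrightarrow> L2_set (\<lambda>j. v j - v j) {a..b}) (at v)"
      unfolding continuous_on_def by blast
    then show "((\<lambda>w. L2_set (\<lambda>j. w j - v j) {a..b}) \<longlongrightarrow> 0) (at v)" by (simp add: L2_set_def)
  qed
  then show ?thesis by (simp add: continuous_on_eq_continuous_at isCont_def)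
qed

lemma sq_argmin_scale:
  assumes P: "\<And>g. P g \<longleftrightarrow> (\<forall>k\<in>C. 0 \<le> sdiff g k)" and C: "C \<subseteq> {a<..<b}" and c: "c > 0"
  shows "sq_argmin P a b (\<lambda>k. c * w k) = (\<lambda>k. c * sq_argmin P a b w k)"
proof -
  obtain g where g: "is_proj C a b w g" using is_proj_exists[OF C] by blast
  show ?thesis unfolding sq_argmin_eq[OF P g] by (rule sq_argmin_eq[OF P is_proj_scale[OF g c]])
qed

lemma conv_in_distr_continuous_map:
  assumes "conv_in_distr M Y N Z" and g: "continuous_on UNIV g"
  shows "conv_in_distr M (\<lambda>n \<omega>. g (Y n \<omega>)) N (\<lambda>\<omega>. g (Z \<omega>))"
proof -
  have "g \<in> borel_measurable borel" using g by (rule borel_measurable_continuous_onI)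
  then have "(\<lambda>\<omega>. g (Y n \<omega>)) \<in> borel_measurable M" "(\<lambda>\<omega>. g (Z \<omega>)) \<in> borel_measurable N" for n
    using assms(1) measurable_compose[of _ _ borel g borel] by (auto simp: conv_in_distr_def)
  moreover have "(\<lambda>n. integral\<^sup>L M (\<lambda>\<omega>. f (g (Y n \<omega>)))) \<longlonglongrightarrow> integral\<^sup>L N (\<lambda>\<omega>. f (g (Z \<omega>)))"
    if f: "continuous_on UNIV f" "bounded (range f)" for f :: "(nat \<Rightarrow> real) \<Rightarrow> real"
  proof -
    have "continuous_on UNIV (\<lambda>x. f (g x))"
      by (rule continuous_on_compose2[OF f(1) g]) simp
    moreover have "bounded (range (\<lambda>x. f (g x)))"
      using f(2) by (rule bounded_subset) auto
    ultimately show ?thesis using assms(1) by (auto simp: conv_in_distr_def)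
  qed
  ultimately show ?thesis by (auto simp: conv_in_distr_def)
qed

text \<open>The difference of the two test values is eventually 0 almost surely and bounded by
  \<open>2 * B\<close>, so its expectation tends to 0 by dominated convergence.\<close>

lemma conv_in_distr_AE_eventually_eq:
  assumes M: "prob_space M" and conv: "conv_in_distr M Y N Z"
    and Y': "\<And>n. Y' n \<in> borel_measurable M"
    and eq: "AE \<omega> in M. eventually (\<lambda>n. Y' n \<omega> = Y n \<omega>) sequentially"
  shows "conv_in_distr M Y' N Z"
proof -
  interpret prob_space M by fact
  have Y: "Y n \<in> borel_measurable M" for n using conv by (simp add: conv_in_distr_def)
  have "(\<lambda>n. expectation (\<lambda>\<omega>. f (Y' n \<omega>))) \<longlonglongrightarrow> integral\<^sup>L N (\<lambda>\<omega>. f (Z \<omega>))"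
    if f: "continuous_on UNIV f" "bounded (range f)" for f :: "(nat \<Rightarrow> real) \<Rightarrow> real"
  proof -
    obtain B where B: "\<And>x. \<bar>f x\<bar> \<le> B" using f(2) unfolding bounded_iff by auto
    have fm: "f \<in> borel_measurable borel" using f(1) by (rule borel_measurable_continuous_onI)
    have [measurable]: "(\<lambda>\<omega>. f (Y n \<omega>)) \<in> borel_measurable M" "(\<lambda>\<omega>. f (Y' n \<omega>)) \<in> borel_measurable M" for n
      using measurable_compose[OF Y fm] measurable_compose[OF Y' fm] by auto
    have int: "integrable M (\<lambda>\<omega>. f (Y n \<omega>))" "integrable M (\<lambda>\<omega>. f (Y' n \<omega>))" for n
      by (rule integrable_const_bound[where B = B]; use B in auto)+
    have "(\<lambda>n. expectation (\<lambda>\<omega>. f (Y' n \<omega>) - f (Y n \<omega>))) \<longlonglongrightarrow> expectation (\<lambda>\<omega>. 0)"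
    proof (rule integral_dominated_convergence[where w = "\<lambda>_. 2 * B"])
      show "AE \<omega> in M. (\<lambda>n. f (Y' n \<omega>) - f (Y n \<omega>)) \<longlonglongrightarrow> 0"
        using eq
      proof eventually_elim
        case (elim \<omega>)
        have "eventually (\<lambda>n. f (Y' n \<omega>) - f (Y n \<omega>) = 0) sequentially"
          using elim by eventually_elim simp
        then show ?case by (rule tendsto_eventually)
      qed
      show "AE \<omega> in M. norm (f (Y' n \<omega>) - f (Y n \<omega>)) \<le> 2 * B" for n
      proof (rule AE_I2)
        fix \<omega> show "norm (f (Y' n \<omega>) - f (Y n \<omega>)) \<le> 2 * B"
          using B[of "Y' n \<omega>"] B[of "Y n \<omega>"] unfolding real_norm_def by linarith
      qed
    qed auto
    moreover have "(\<lambda>n. expectation (\<lambda>\<omega>. f (Y n \<omega>))) \<longlonglongrightarrow> integral\<^sup>L N (\<lambda>\<omega>. f (Z \<omega>))"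
      using conv f by (simp add: conv_in_distr_def)
    ultimately have "(\<lambda>n. expectation (\<lambda>\<omega>. f (Y' n \<omega>) - f (Y n \<omega>)) + expectation (\<lambda>\<omega>. f (Y n \<omega>)))
        \<longlonglongrightarrow> 0 + integral\<^sup>L N (\<lambda>\<omega>. f (Z \<omega>))"
      by (intro tendsto_add) auto
    then show ?thesis using int by simp
  qed
  then show ?thesis using conv Y' by (simp add: conv_in_distr_def)
qed

context iid_sample
begin

theorem emp_pmf_clt:
  assumes supp: "set_pmf q = {0..S}" and U: "brownian_bridge N U"
  shows "conv_in_distr M (\<lambda>n \<omega> k. sqrt (real n) * (emp_pmf X n \<omega> k - pmf q k)) N
    (\<lambda>\<omega> j. U (\<Sum>i\<le>j. pmf q i) \<omega> - U (if j = 0 then 0 else \<Sum>i\<le>j - 1. pmf q i) \<omega>)"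
    (is "conv_in_distr M ?Y N ?W")
proof -
  interpret N: prob_space N using U by (simp add: brownian_bridge_def)
  \<comment> \<open>\<open>t j\<close> is the distribution function just before \<open>j\<close>,
    with \<open>t 0 = 0\<close>; the limit vector consists of the increments of \<open>U\<close>
    along \<open>t\<close>.\<close>
  define t where "t j = (\<Sum>i<j. pmf q i)" for j
  have tS: "t (Suc j) = t j + pmf q j" for j by (simp add: t_def)
  have t01: "t j \<in> {0..1}" for j
    using measure_measure_pmf_finite[of "{..<j}" q] measure_pmf.prob_le_1[of q "{..<j}"]
    by (auto simp: t_def sum_nonneg)
  have W: "?W \<omega> j = U (t (Suc j)) \<omega> - U (t j) \<omega>" for \<omega> j
    by (cases j) (auto simp: t_def lessThan_Suc_atMost)
  have pos: "pmf q j > 0" if "j \<le> S" for j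
    using that supp by (auto intro: pmf_positive)
  have zero: "pmf q j = 0" if "j > S" for j
    using that supp by (simp add: set_pmf_iff[symmetric] pmf_eq_0_set_pmf)
  show ?thesis
  proof (rule cramer_wold[where m = S])
    show "prob_space M" "prob_space N" by unfold_locales
    show "?Y n \<in> borel_measurable M" for n
      by (intro measurable_coordinatewise_then_product borel_measurable_times borel_measurable_diff
          emp_pmf_meas borel_measurable_const)
    have Um: "U (t j) \<in> borel_measurable N" for j
      using U t01 by (simp add: brownian_bridge_def)
    show "?W \<in> borel_measurable N"
      unfolding W by (intro measurable_coordinatewise_then_product borel_measurable_diff Um)
    show "AE \<omega> in M. \<forall>k>S. ?Y n \<omega> k = 0" for n
    proof -
      have "AE \<omega> in M. \<forall>i. X i \<omega> \<le> S"
        unfolding AE_all_countable using AE_X[where P = "\<lambda>x. x \<le> S"] supp by simp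
      then show ?thesis
      proof eventually_elim
        case (elim \<omega>)
        have "X i \<omega> \<noteq> k" if "k > S" for i k using elim that by (metis not_less)
        then show ?case by (simp add: emp_pmf_def zero)
      qed
    qed
    \<comment> \<open>Past \<open>S\<close> the times no longer move, so the increment cancels
      identically.\<close>
    show "AE \<omega> in N. \<forall>k>S. ?W \<omega> k = 0"
      unfolding W tS by (simp add: zero)
    show "\<exists>L. \<forall>n. prob {\<omega> \<in> space M. \<exists>k\<le>S. \<bar>?Y n \<omega> k\<bar> > L} \<le> e" if "e > 0" for e
      using that by (rule emp_pmf_tight)
    show "(\<lambda>n. expectation (\<lambda>\<omega>. cos ((\<Sum>i\<le>S. a i * ?Y n \<omega> i) + b))) \<longlonglongrightarrow>
      N.expectation (\<lambda>\<omega>. cos ((\<Sum>i\<le>S. a i * ?W \<omega> i) + b))" for a b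
    proof -
      have "centered_normal N (\<lambda>\<omega>. \<Sum>i\<le>S. a i * ?W \<omega> i)
          ((\<Sum>i\<le>S. (a i)\<^sup>2 * pmf q i) - (\<Sum>i\<le>S. a i * pmf q i)\<^sup>2)"
        unfolding W by (rule bridge_increments_centered_normal[where t = t and r = "pmf q" and n = S, OF U tS t01 pos])
      from centered_normal_cos[OF N.prob_space_axioms this] show ?thesis
        using emp_pmf_linear_clt by simp
    qed
  qed
qed

end

theorem theorem6:
  fixes p0 :: "nat pmf" and S :: nat
    and M :: "'a measure" and X :: "nat \<Rightarrow> 'a \<Rightarrow> nat"
    and N :: "'b measure" and U :: "real \<Rightarrow> 'b \<Rightarrow> real"
    and K :: "nat set" and s s' z z' :: nat
  assumes S_pos: "S \<ge> 1"
    and supp: "set_pmf p0 = {0..S}"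
    and p0_convex: "convex_seq (pmf p0)"
    and M: "prob_space M"
    and X_meas: "\<And>i. X i \<in> measurable M (count_space UNIV)"
    and X_indep: "prob_space.indep_vars M (\<lambda>_. count_space UNIV) X UNIV"
    and X_distr: "\<And>i. distr M (count_space UNIV) (X i) = measure_pmf p0"
    and U: "brownian_bridge N U"
    and K: "finite K" "K \<noteq> {}"
    and s: "s \<le> Min K" "s = 0 \<or> (s \<ge> 1 \<and> double_knot (pmf p0) (s - 1))"
    and s': "s' \<ge> Max K" "double_knot (pmf p0) s' \<or> s' \<ge> S + 1"
    and z: "z \<le> s" "z' \<ge> s'"
  shows "(AE \<omega> in M. \<exists>n0. \<forall>n\<ge>n0. \<forall>k\<in>K.
            convex_lse (emp_pmf X n \<omega>) k =
            sq_argmin (\<lambda>g. convex_on_range g z z') z z' (emp_pmf X n \<omega>) k)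
       \<and> conv_in_distr M
           (\<lambda>n \<omega> k. if k \<in> K then sqrt (real n) * (convex_lse (emp_pmf X n \<omega>) k - pmf p0 k) else 0)
           N
           (\<lambda>\<omega> k. if k \<in> K then
               sq_argmin (piecewise_convex (pmf p0) S z z') z z'
                 (\<lambda>j. U (\<Sum>i\<le>j. pmf p0 i) \<omega> - U (if j = 0 then 0 else \<Sum>i\<le>j - 1. pmf p0 i) \<omega>) k
             else 0)"
    (is "?local \<and> conv_in_distr M ?L N ?G")
proof -
  interpret iid_sample M X p0
    by (intro iid_sample.intro iid_sample_axioms.intro M X_meas X_indep X_distr)
  interpret p: convex_finite_support "pmf p0" S
  proof
    show "pmf p0 k > 0" if "k \<le> S" for k using that supp by (auto intro: pmf_positive)
    show "pmf p0 k = 0" if "k > S" for k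
      using that supp by (simp add: set_pmf_iff[symmetric] pmf_eq_0_set_pmf)
  qed (use S_pos p0_convex in auto)
  have Ks: "k \<in> {s..s'}" if "k \<in> K" for k
    using that K s(1) s'(1) by (auto dest: Min_le[OF K(1)] Max_ge[OF K(1)])
  then have ss: "s \<le> s'" using K(2) by fastforce
  let ?P = "piecewise_convex (pmf p0) S z z'"
  obtain d where d: "d > 0"
    and local: "\<And>y k. (\<And>j. j > S \<Longrightarrow> y j = 0) \<Longrightarrow> (\<And>j. j \<le> S \<Longrightarrow> \<bar>y j - pmf p0 j\<bar> \<le> d) \<Longrightarrow> k \<in> {s..s'} \<Longrightarrow>
       convex_lse y k = sq_argmin (\<lambda>g. convex_on_range g z z') z z' y k"
    and centred: "\<And>y k. (\<And>j. j > S \<Longrightarrow> y j = 0) \<Longrightarrow> (\<And>j. j \<le> S \<Longrightarrow> \<bar>y j - pmf p0 j\<bar> \<le> d) \<Longrightarrow> k \<in> {s..s'} \<Longrightarrow>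
       convex_lse y k - pmf p0 k = sq_argmin ?P z z' (\<lambda>j. y j - pmf p0 j) k"
    using p.convex_lse_local[OF s(2) s'(2) z(1) ss z(2)] by blast
  have near: "AE \<omega> in M. eventually (\<lambda>n. (\<forall>j>S. emp_pmf X n \<omega> j = 0) \<and>
      (\<forall>j\<le>S. \<bar>emp_pmf X n \<omega> j - pmf p0 j\<bar> \<le> d)) sequentially"
  proof -
    have "AE \<omega> in M. \<forall>i. X i \<omega> \<le> S"
      unfolding AE_all_countable using AE_X[where P = "\<lambda>x. x \<le> S"] supp by simp
    then show ?thesis using emp_pmf_slln
    proof eventually_elim
      case (elim \<omega>)
      have "X i \<omega> \<noteq> j" if "j > S" for i j using elim(1) that by (metis not_less)
      then have zero: "emp_pmf X n \<omega> j = 0" if "j > S" for n j using that by (simp add: emp_pmf_def)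
      have "eventually (\<lambda>n. \<forall>j\<in>{..S}. dist (emp_pmf X n \<omega> j) (pmf p0 j) < d) sequentially"
        using elim(2) d by (intro eventually_ball_finite finite_atMost ballI tendstoD) auto
      then show ?case
      proof eventually_elim
        case (elim n)
        then show ?case using zero by (auto simp: dist_real_def intro: less_imp_le)
      qed
    qed
  qed
  have P: "?P g \<longleftrightarrow> (\<forall>k\<in>p.piece_points z z'. 0 \<le> sdiff g k)" for g by (rule p.piecewise_convex_iff)
  have C: "p.piece_points z z' \<subseteq> {z<..<z'}" using p.piece_points_subset by blast
  let ?Y = "\<lambda>n \<omega> k. sqrt (real n) * (emp_pmf X n \<omega> k - pmf p0 k)"
  \<comment> \<open>The continuous map of the limit theorem; coordinates outside \<open>K\<close>
    are set to 0 as in the statement.\<close>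
  define \<Phi> where "\<Phi> w = (\<lambda>k. if k \<in> K then sq_argmin ?P z z' w k else 0)" for w
  have "continuous_on UNIV (\<lambda>w. \<Phi> w k)" for k
    unfolding \<Phi>_def by (cases "k \<in> K") (auto intro: continuous_on_sq_argmin[OF P C])
  then have \<Phi>: "continuous_on UNIV \<Phi>" by (rule continuous_on_coordinatewise_then_product)
  have lse_eq: "AE \<omega> in M. eventually (\<lambda>n. ?L n \<omega> = \<Phi> (?Y n \<omega>)) sequentially"
    using near
  proof eventually_elim
    case (elim \<omega>)
    \<comment> \<open>Positive \<open>n\<close> makes \<open>sqrt n\<close> a positive factor, as
      homogeneity requires.\<close>
    then show ?case using eventually_gt_at_top[of 0]
    proof eventually_elim
      case (elim n)
      have "sqrt (real n) * (convex_lse (emp_pmf X n \<omega>) k - pmf p0 k) = sq_argmin ?P z z' (?Y n \<omega>) k"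
        if "k \<in> K" for k
        using centred[of "emp_pmf X n \<omega>" k] Ks[OF that] elim
          sq_argmin_scale[OF P C, of "sqrt (real n)" "\<lambda>j. emp_pmf X n \<omega> j - pmf p0 j"] by simp
      then show ?case by (auto simp: \<Phi>_def)
    qed
  qed
  \<comment> \<open>The estimator is identified with a continuous function of the data only near
    \<open>p0\<close>; its measurability for each fixed \<open>n\<close> comes from the sample being
    finite and discrete.\<close>
  have "?L n \<in> borel_measurable M" for n
  proof (rule sample_function_meas)
    fix \<omega> \<omega>' assume "\<And>i. i < n \<Longrightarrow> X i \<omega> = X i \<omega>'"
    then have "emp_pmf X n \<omega> = emp_pmf X n \<omega>'"
      by (auto simp: emp_pmf_def fun_eq_iff intro!: arg_cong[where f = card])
    then show "?L n \<omega> = ?L n \<omega>'" by (simp cong: if_cong)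
  qed
  then have "conv_in_distr M ?L N (\<lambda>\<omega>. \<Phi> (\<lambda>j. U (\<Sum>i\<le>j. pmf p0 i) \<omega> - U (if j = 0 then 0 else \<Sum>i\<le>j - 1. pmf p0 i) \<omega>))"
    by (intro conv_in_distr_AE_eventually_eq[OF M conv_in_distr_continuous_map[OF emp_pmf_clt[OF supp U] \<Phi>] _ lse_eq])
  moreover have ?local
    using near
  proof eventually_elim
    case (elim \<omega>)
    then obtain n0 where n0: "\<And>n. n \<ge> n0 \<Longrightarrow> (\<forall>j>S. emp_pmf X n \<omega> j = 0) \<and>
      (\<forall>j\<le>S. \<bar>emp_pmf X n \<omega> j - pmf p0 j\<bar> \<le> d)" by (auto simp: eventually_sequentially)
    show ?case
    proof (intro exI[of _ n0] allI impI ballI)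
      fix n k assume n: "n0 \<le> n" and k: "k \<in> K"
      show "convex_lse (emp_pmf X n \<omega>) k = sq_argmin (\<lambda>g. convex_on_range g z z') z z' (emp_pmf X n \<omega>) k"
        by (rule local[OF _ _ Ks[OF k]]) (use n0[OF n] in auto)
    qed
  qed
  ultimately show ?thesis by (simp add: \<Phi>_def)
qed

end
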